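(* Given two PCF programs $P_1,P_2$ of type $\alpha$, we have $P_1\equiv_{\mathrm{obs}}P_2\Rightarrow\mathrm{Tr}(P_1)\equiv_\alpha\mathrm{Tr}(P_2)$.
   Context: $\mathrm{Tr}(P)$ is the extended addressing machine (EAM) obtained from the closed PCF term $P$ by the paper's type-preserving translation of (E)PCF terms into EAMs. EAMs run over a set $\mathbb A\supseteq\mathbb N$ of addresses with a bijective address map $\#$ ($\mathsf n$ the numeral machine of address $n$), $\mathsf M@[a]$ appends $a$ to the input tape, and $\twoheadrightarrow_{\mathsf c}$ is multi-step EAM reduction. With $\mathcal D_\alpha=\{a\mid \#^{-1}(a):\alpha\}$, the logical relation is: $\mathsf M\equiv_{\mathsf{int}}\mathsf N$ iff $\forall n,\ \mathsf M\twoheadrightarrow_{\mathsf c}\mathsf n\iff\mathsf N\twoheadrightarrow_{\mathsf c}\mathsf n$; $\mathsf M\equiv_{\alpha\to\beta}\mathsf N$ iff for all $a,b\in\mathcal D_\alpha$ with $\#^{-1}(a)\equiv_\alpha\#^{-1}(b)$, $\mathsf M@[a]\equiv_\beta\mathsf N@[b]$. $P_1\equiv_{\mathrm{obs}}P_2$ means that for every PCF context $C[\cdot]$ of type $\mathsf{int}$, $C[P_1]\twoheadrightarrow_{\sf PCF}\underline n\iff C[P_2]\twoheadrightarrow_{\sf PCF}\underline n$. *)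

theory Defs
  imports Main
begin

section \<open>PCF\<close>

datatype ty = IntT | Arrow ty ty (infixr "\<rightarrow>\<^sub>t" 60)

text \<open>
  Terms up to renaming of bound variables: variables are de Bruijn indices, abstractions are not
  annotated.
\<close>

datatype pcf =
    Var nat
  | App pcf pcf
  | Lam pcf
  | Fix pcf
  | Zero
  | Pred pcf
  | Succ pcf
  | Ifz pcf pcf pcf

primrec numeral_pcf :: "nat \<Rightarrow> pcf" where
  "numeral_pcf 0 = Zero"
| "numeral_pcf (Suc n) = Succ (numeral_pcf n)"

primrec lift :: "nat \<Rightarrow> pcf \<Rightarrow> pcf" where
  "lift k (Var i) = (if i < k then Var i else Var (Suc i))"
| "lift k (App P Q) = App (lift k P) (lift k Q)"
| "lift k (Lam P) = Lam (lift (Suc k) P)"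
| "lift k (Fix P) = Fix (lift k P)"
| "lift k Zero = Zero"
| "lift k (Pred P) = Pred (lift k P)"
| "lift k (Succ P) = Succ (lift k P)"
| "lift k (Ifz L P Q) = Ifz (lift k L) (lift k P) (lift k Q)"

text \<open>
  \<open>subst k N P\<close> replaces the variable \<open>k\<close> of \<open>P\<close> by \<open>N\<close> and removes \<open>k\<close> from the scope.
\<close>

primrec subst :: "nat \<Rightarrow> pcf \<Rightarrow> pcf \<Rightarrow> pcf" where
  "subst k N (Var i) = (if i < k then Var i else if i = k then N else Var (i - 1))"
| "subst k N (App P Q) = App (subst k N P) (subst k N Q)"
| "subst k N (Lam P) = Lam (subst (Suc k) (lift 0 N) P)"
| "subst k N (Fix P) = Fix (subst k N P)"
| "subst k N Zero = Zero"
| "subst k N (Pred P) = Pred (subst k N P)"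
| "subst k N (Succ P) = Succ (subst k N P)"
| "subst k N (Ifz L P Q) = Ifz (subst k N L) (subst k N P) (subst k N Q)"

text \<open>Weak head (call-by-name) reduction.\<close>

inductive pcf_step :: "pcf \<Rightarrow> pcf \<Rightarrow> bool" (infix "\<rightarrow>\<^sub>P" 50) where
  beta: "App (Lam P) Q \<rightarrow>\<^sub>P subst 0 Q P"
| unfold_fix: "Fix P \<rightarrow>\<^sub>P App P (Fix P)"
| pred_zero: "Pred Zero \<rightarrow>\<^sub>P Zero"
| pred_succ: "Pred (numeral_pcf (Suc n)) \<rightarrow>\<^sub>P numeral_pcf n"
| ifz_zero: "Ifz Zero P Q \<rightarrow>\<^sub>P P"
| ifz_succ: "Ifz (numeral_pcf (Suc n)) P Q \<rightarrow>\<^sub>P Q"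
| ctx_app: "P \<rightarrow>\<^sub>P P' \<Longrightarrow> App P Q \<rightarrow>\<^sub>P App P' Q"
| ctx_pred: "P \<rightarrow>\<^sub>P P' \<Longrightarrow> Pred P \<rightarrow>\<^sub>P Pred P'"
| ctx_succ: "P \<rightarrow>\<^sub>P P' \<Longrightarrow> Succ P \<rightarrow>\<^sub>P Succ P'"
| ctx_ifz: "L \<rightarrow>\<^sub>P L' \<Longrightarrow> Ifz L P Q \<rightarrow>\<^sub>P Ifz L' P Q"

abbreviation pcf_steps :: "pcf \<Rightarrow> pcf \<Rightarrow> bool" (infix "\<rightarrow>\<^sub>P*" 50) where
  "pcf_steps \<equiv> pcf_step\<^sup>*\<^sup>*"

text \<open>Typing environments are lists, the type of variable \<open>i\<close> being the \<open>i\<close>-th entry.\<close>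

inductive pcf_typed :: "ty list \<Rightarrow> pcf \<Rightarrow> ty \<Rightarrow> bool" where
  "i < length \<Gamma> \<Longrightarrow> pcf_typed \<Gamma> (Var i) (\<Gamma> ! i)"
| "pcf_typed \<Gamma> P (\<alpha> \<rightarrow>\<^sub>t \<beta>) \<Longrightarrow> pcf_typed \<Gamma> Q \<alpha> \<Longrightarrow> pcf_typed \<Gamma> (App P Q) \<beta>"
| "pcf_typed (\<alpha> # \<Gamma>) P \<beta> \<Longrightarrow> pcf_typed \<Gamma> (Lam P) (\<alpha> \<rightarrow>\<^sub>t \<beta>)"
| "pcf_typed \<Gamma> P (\<alpha> \<rightarrow>\<^sub>t \<alpha>) \<Longrightarrow> pcf_typed \<Gamma> (Fix P) \<alpha>"
| "pcf_typed \<Gamma> Zero IntT"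
| "pcf_typed \<Gamma> P IntT \<Longrightarrow> pcf_typed \<Gamma> (Pred P) IntT"
| "pcf_typed \<Gamma> P IntT \<Longrightarrow> pcf_typed \<Gamma> (Succ P) IntT"
| "pcf_typed \<Gamma> L IntT \<Longrightarrow> pcf_typed \<Gamma> P \<alpha> \<Longrightarrow> pcf_typed \<Gamma> Q \<alpha> \<Longrightarrow> pcf_typed \<Gamma> (Ifz L P Q) \<alpha>"

text \<open>Programs are closed terms; a term typable in the empty environment is closed.\<close>

abbreviation pcf_program :: "pcf \<Rightarrow> ty \<Rightarrow> bool" where
  "pcf_program P \<alpha> \<equiv> pcf_typed [] P \<alpha>"

datatype pcf_ctx =
    Hole
  | CAppL pcf_ctx pcf
  | CAppR pcf pcf_ctx
  | CLam pcf_ctx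
  | CFix pcf_ctx
  | CPred pcf_ctx
  | CSucc pcf_ctx
  | CIfz1 pcf_ctx pcf pcf
  | CIfz2 pcf pcf_ctx pcf
  | CIfz3 pcf pcf pcf_ctx

primrec plug :: "pcf_ctx \<Rightarrow> pcf \<Rightarrow> pcf" where
  "plug Hole P = P"
| "plug (CAppL C Q) P = App (plug C P) Q"
| "plug (CAppR Q C) P = App Q (plug C P)"
| "plug (CLam C) P = Lam (plug C P)"
| "plug (CFix C) P = Fix (plug C P)"
| "plug (CPred C) P = Pred (plug C P)"
| "plug (CSucc C) P = Succ (plug C P)"
| "plug (CIfz1 C Q Q') P = Ifz (plug C P) Q Q'"
| "plug (CIfz2 L C Q') P = Ifz L (plug C P) Q'"
| "plug (CIfz3 L Q C) P = Ifz L Q (plug C P)"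

text \<open>
  \<open>ctx_typed \<alpha> \<Gamma> C \<beta>\<close>: with a hole standing for closed terms of type \<open>\<alpha>\<close>, the context \<open>C\<close> has type \<open>\<beta>\<close>.
\<close>

inductive ctx_typed :: "ty \<Rightarrow> ty list \<Rightarrow> pcf_ctx \<Rightarrow> ty \<Rightarrow> bool" for \<alpha> :: ty where
  "ctx_typed \<alpha> \<Gamma> Hole \<alpha>"
| "ctx_typed \<alpha> \<Gamma> C (\<beta> \<rightarrow>\<^sub>t \<gamma>) \<Longrightarrow> pcf_typed \<Gamma> Q \<beta> \<Longrightarrow> ctx_typed \<alpha> \<Gamma> (CAppL C Q) \<gamma>"
| "pcf_typed \<Gamma> Q (\<beta> \<rightarrow>\<^sub>t \<gamma>) \<Longrightarrow> ctx_typed \<alpha> \<Gamma> C \<beta> \<Longrightarrow> ctx_typed \<alpha> \<Gamma> (CAppR Q C) \<gamma>"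
| "ctx_typed \<alpha> (\<beta> # \<Gamma>) C \<gamma> \<Longrightarrow> ctx_typed \<alpha> \<Gamma> (CLam C) (\<beta> \<rightarrow>\<^sub>t \<gamma>)"
| "ctx_typed \<alpha> \<Gamma> C (\<beta> \<rightarrow>\<^sub>t \<beta>) \<Longrightarrow> ctx_typed \<alpha> \<Gamma> (CFix C) \<beta>"
| "ctx_typed \<alpha> \<Gamma> C IntT \<Longrightarrow> ctx_typed \<alpha> \<Gamma> (CPred C) IntT"
| "ctx_typed \<alpha> \<Gamma> C IntT \<Longrightarrow> ctx_typed \<alpha> \<Gamma> (CSucc C) IntT"
| "ctx_typed \<alpha> \<Gamma> C IntT \<Longrightarrow> pcf_typed \<Gamma> P \<beta> \<Longrightarrow> pcf_typed \<Gamma> Q \<beta> \<Longrightarrow> ctx_typed \<alpha> \<Gamma> (CIfz1 C P Q) \<beta>"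
| "pcf_typed \<Gamma> L IntT \<Longrightarrow> ctx_typed \<alpha> \<Gamma> C \<beta> \<Longrightarrow> pcf_typed \<Gamma> Q \<beta> \<Longrightarrow> ctx_typed \<alpha> \<Gamma> (CIfz2 L C Q) \<beta>"
| "pcf_typed \<Gamma> L IntT \<Longrightarrow> pcf_typed \<Gamma> P \<beta> \<Longrightarrow> ctx_typed \<alpha> \<Gamma> C \<beta> \<Longrightarrow> ctx_typed \<alpha> \<Gamma> (CIfz3 L P C) \<beta>"

text \<open>Observational equivalence of programs of type \<open>\<alpha>\<close>.\<close>

definition obs_equiv :: "ty \<Rightarrow> pcf \<Rightarrow> pcf \<Rightarrow> bool" where
  "obs_equiv \<alpha> P\<^sub>1 P\<^sub>2 \<longleftrightarrow>
    (\<forall>C. ctx_typed \<alpha> [] C IntT \<longrightarrow>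
      (\<forall>n. plug C P\<^sub>1 \<rightarrow>\<^sub>P* numeral_pcf n \<longleftrightarrow> plug C P\<^sub>2 \<rightarrow>\<^sub>P* numeral_pcf n))"


section \<open>Extended addressing machines\<close>

text \<open>
  A program is a sequence of \<open>Load\<close>s, followed by operations, and ends with \<open>Call i\<close> or with the
  empty program. \<open>AppI k i j A\<close> is \<open>k \<leftarrow> App(i,j); A\<close>, and similarly \<open>PredI k i A\<close> and \<open>SuccI k i A\<close>;
  \<open>TestI l i j k A\<close> is \<open>l \<leftarrow> Test(i,j,k); A\<close>.
\<close>

datatype body =
    Eps
  | Call nat
  | AppI nat nat nat body
  | TestI nat nat nat nat body
  | PredI nat nat body
  | SuccI nat nat body

datatype program = Load nat program | Body body

text \<open>Registers contain an address or are uninitialised (\<open>None\<close>).\<close>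

datatype 'a eam = EAM (regs: "'a option list") (prog: program) (tape: "'a list")

text \<open>
  Validity with respect to \<open>r\<close> registers, those in \<open>I\<close> being initialised: only initialised registers
  are read. Writing to a register that does not exist is allowed, the value is then discarded.
\<close>

definition initialise :: "nat \<Rightarrow> nat set \<Rightarrow> nat \<Rightarrow> nat set" where
  "initialise r I k = (if k < r then insert k I else I)"

primrec valid_body :: "nat \<Rightarrow> nat set \<Rightarrow> body \<Rightarrow> bool" where
  "valid_body r I Eps \<longleftrightarrow> True"
| "valid_body r I (Call i) \<longleftrightarrow> i \<in> I"
| "valid_body r I (AppI k i j A) \<longleftrightarrow> i \<in> I \<and> j \<in> I \<and> valid_body r (initialise r I k) A"
| "valid_body r I (TestI l i j k A) \<longleftrightarrow>
    i \<in> I \<and> j \<in> I \<and> k \<in> I \<and> valid_body r (initialise r I l) A"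
| "valid_body r I (PredI k i A) \<longleftrightarrow> i \<in> I \<and> valid_body r (initialise r I k) A"
| "valid_body r I (SuccI k i A) \<longleftrightarrow> i \<in> I \<and> valid_body r (initialise r I k) A"

primrec valid_program :: "nat \<Rightarrow> nat set \<Rightarrow> program \<Rightarrow> bool" where
  "valid_program r I (Load i P) \<longleftrightarrow> valid_program r (initialise r I i) P"
| "valid_program r I (Body A) \<longleftrightarrow> valid_body r I A"

text \<open>The type \<open>'a eam\<close> is one of raw tuples; the machines over \<open>'a\<close> are the following ones.\<close>

definition machines :: "'a eam set" where
  "machines = {M. valid_program (length (regs M))
                    {i. i < length (regs M) \<and> regs M ! i \<noteq> None} (prog M)}"

definition append_tape :: "'a eam \<Rightarrow> 'a list \<Rightarrow> 'a eam" (infixl "@@" 65) where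
  "M @@ as = EAM (regs M) (prog M) (tape M @ as)"

definition reads :: "'a option list \<Rightarrow> nat \<Rightarrow> 'a \<Rightarrow> bool" where
  "reads R i a \<longleftrightarrow> i < length R \<and> R ! i = Some a"

definition numeral_eam :: "(nat \<Rightarrow> 'a) \<Rightarrow> nat \<Rightarrow> 'a eam" where
  "numeral_eam num n = EAM [Some (num n)] (Body Eps) []"

text \<open>
  When \<open>a\<close> is the address of this very machine, it is a fixed point combinator: on input \<open>b\<close> it
  becomes the machine of address \<open>b\<close> with \<open>a \<cdot> b\<close> appended to its tape (\<open>\<cdot>\<close> is \<open>dot\<close> below).
\<close>

definition Y_eam :: "'a \<Rightarrow> 'a eam" where
  "Y_eam a = EAM [None, Some a] (Load 0 (Body (AppI 1 1 0 (AppI 1 0 1 (Call 1))))) []"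

text \<open>
  The addresses are the elements of \<open>'a\<close>, with \<open>num\<close> the inclusion of the natural numbers into them.
  The address map \<open>addr\<close> is a bijection from machines to addresses that gives the numeral machine of
  \<open>n\<close> the address \<open>n\<close> and for which there is a fixed point machine, with address \<open>y\<close>.
\<close>

locale address_map =
  fixes num :: "nat \<Rightarrow> 'a"
    and addr :: "'a eam \<Rightarrow> 'a"
    and y :: 'a
  assumes inj_num: "inj num"
    and bij_addr: "bij_betw addr machines UNIV"
    and addr_numeral: "\<And>n. addr (numeral_eam num n) = num n"
    and addr_Y: "addr (Y_eam y) = y"
begin

definition lookup :: "'a \<Rightarrow> 'a eam" where
  "lookup = the_inv_into machines addr"

definition dot :: "'a \<Rightarrow> 'a \<Rightarrow> 'a" where
  "dot a b = addr (lookup a @@ [b])"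


subsection \<open>Reduction\<close>

text \<open>Note that \<open>R[k := v]\<close> is \<open>R\<close> when there is no register \<open>k\<close>.\<close>

inductive step :: "'a eam \<Rightarrow> 'a eam \<Rightarrow> bool" (infix "\<rightarrow>\<^sub>c" 50) where
  Load: "EAM R (Load i P) (a # T) \<rightarrow>\<^sub>c EAM (R[i := Some a]) P T"
| Call: "reads R i a \<Longrightarrow> EAM R (Body (Call i)) T \<rightarrow>\<^sub>c lookup a @@ T"
| App: "reads R i a \<Longrightarrow> reads R j b \<Longrightarrow>
    EAM R (Body (AppI k i j A)) T \<rightarrow>\<^sub>c EAM (R[k := Some (dot a b)]) (Body A) T"
| Pred: "reads R i a \<Longrightarrow> lookup a = numeral_eam num n \<Longrightarrow>
    EAM R (Body (PredI k i A)) T \<rightarrow>\<^sub>c EAM (R[k := Some (num (n - 1))]) (Body A) T"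
| Succ: "reads R i a \<Longrightarrow> lookup a = numeral_eam num n \<Longrightarrow>
    EAM R (Body (SuccI k i A)) T \<rightarrow>\<^sub>c EAM (R[k := Some (num (n + 1))]) (Body A) T"
| Test_zero: "reads R i a \<Longrightarrow> lookup a = numeral_eam num 0 \<Longrightarrow> reads R j b \<Longrightarrow>
    EAM R (Body (TestI l i j k A)) T \<rightarrow>\<^sub>c EAM (R[l := Some b]) (Body A) T"
| Test_succ: "reads R i a \<Longrightarrow> lookup a = numeral_eam num (Suc n) \<Longrightarrow> reads R k c \<Longrightarrow>
    EAM R (Body (TestI l i j k A)) T \<rightarrow>\<^sub>c EAM (R[l := Some c]) (Body A) T"
| Pred_arg: "reads R i a \<Longrightarrow> lookup a \<rightarrow>\<^sub>c M \<Longrightarrow>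
    EAM R (Body (PredI k i A)) T \<rightarrow>\<^sub>c EAM (R[i := Some (addr M)]) (Body (PredI k i A)) T"
| Succ_arg: "reads R i a \<Longrightarrow> lookup a \<rightarrow>\<^sub>c M \<Longrightarrow>
    EAM R (Body (SuccI k i A)) T \<rightarrow>\<^sub>c EAM (R[i := Some (addr M)]) (Body (SuccI k i A)) T"
| Test_arg: "reads R i a \<Longrightarrow> lookup a \<rightarrow>\<^sub>c M \<Longrightarrow>
    EAM R (Body (TestI l i j k A)) T \<rightarrow>\<^sub>c EAM (R[i := Some (addr M)]) (Body (TestI l i j k A)) T"

abbreviation steps :: "'a eam \<Rightarrow> 'a eam \<Rightarrow> bool" (infix "\<rightarrow>\<^sub>c*" 50) where
  "steps \<equiv> step\<^sup>*\<^sup>*"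


subsection \<open>Typing\<close>

definition set_ty :: "nat \<Rightarrow> (nat \<rightharpoonup> ty) \<Rightarrow> nat \<Rightarrow> ty \<Rightarrow> (nat \<rightharpoonup> ty)" where
  "set_ty r \<Delta> i \<beta> = (if i < r then \<Delta>(i \<mapsto> \<beta>) else \<Delta>)"

text \<open>
  \<open>\<Delta>\<close> assigns types to the initialised registers. In \<open>body_typed r \<Delta> A T \<alpha>\<close> and
  \<open>program_typed r \<Delta> P T \<alpha>\<close> the number of registers is \<open>r\<close> and the input tape is \<open>T\<close>. The first two
  rules are needed because the empty program has no type and because \<open>Y_eam y\<close> stores its own address.
\<close>

inductive eam_typed :: "'a eam \<Rightarrow> ty \<Rightarrow> bool"
  and regs_typed :: "'a option list \<Rightarrow> (nat \<rightharpoonup> ty) \<Rightarrow> bool"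
  and program_typed :: "nat \<Rightarrow> (nat \<rightharpoonup> ty) \<Rightarrow> program \<Rightarrow> 'a list \<Rightarrow> ty \<Rightarrow> bool"
  and body_typed :: "nat \<Rightarrow> (nat \<rightharpoonup> ty) \<Rightarrow> body \<Rightarrow> 'a list \<Rightarrow> ty \<Rightarrow> bool"
  and tape_typed :: "'a list \<Rightarrow> ty list \<Rightarrow> bool"
where
  T_num: "eam_typed (numeral_eam num n) IntT"
| T_fix: "eam_typed (Y_eam y) ((\<alpha> \<rightarrow>\<^sub>t \<alpha>) \<rightarrow>\<^sub>t \<alpha>)"
| T_eam: "regs_typed R \<Delta> \<Longrightarrow> program_typed (length R) \<Delta> P T \<alpha> \<Longrightarrow> eam_typed (EAM R P T) \<alpha>"
| T_regs_Nil: "regs_typed [] Map.empty"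
| T_regs_None: "regs_typed R \<Delta> \<Longrightarrow> regs_typed (R @ [None]) \<Delta>"
| T_regs_Some: "regs_typed R \<Delta> \<Longrightarrow> eam_typed (lookup a) \<beta> \<Longrightarrow>
    regs_typed (R @ [Some a]) (\<Delta>(length R \<mapsto> \<beta>))"
| T_load_empty: "program_typed r (set_ty r \<Delta> i \<beta>) P [] \<alpha> \<Longrightarrow>
    program_typed r \<Delta> (Load i P) [] (\<beta> \<rightarrow>\<^sub>t \<alpha>)"
| T_load: "eam_typed (lookup a) \<beta> \<Longrightarrow> program_typed r (set_ty r \<Delta> i \<beta>) P T \<alpha> \<Longrightarrow>
    program_typed r \<Delta> (Load i P) (a # T) \<alpha>"
| T_body: "body_typed r \<Delta> A T \<alpha> \<Longrightarrow> program_typed r \<Delta> (Body A) T \<alpha>"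
| T_app: "\<Delta> i = Some (\<beta> \<rightarrow>\<^sub>t \<gamma>) \<Longrightarrow> \<Delta> j = Some \<beta> \<Longrightarrow> body_typed r (set_ty r \<Delta> k \<gamma>) A T \<alpha> \<Longrightarrow>
    body_typed r \<Delta> (AppI k i j A) T \<alpha>"
| T_test: "\<Delta> i = Some IntT \<Longrightarrow> \<Delta> j = Some \<beta> \<Longrightarrow> \<Delta> k = Some \<beta> \<Longrightarrow>
    body_typed r (set_ty r \<Delta> l \<beta>) A T \<alpha> \<Longrightarrow> body_typed r \<Delta> (TestI l i j k A) T \<alpha>"
| T_pred: "\<Delta> i = Some IntT \<Longrightarrow> body_typed r (set_ty r \<Delta> k IntT) A T \<alpha> \<Longrightarrow>
    body_typed r \<Delta> (PredI k i A) T \<alpha>"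
| T_succ: "\<Delta> i = Some IntT \<Longrightarrow> body_typed r (set_ty r \<Delta> k IntT) A T \<alpha> \<Longrightarrow>
    body_typed r \<Delta> (SuccI k i A) T \<alpha>"
| T_call: "\<Delta> i = Some (foldr (\<rightarrow>\<^sub>t) \<beta>s \<alpha>) \<Longrightarrow> tape_typed T \<beta>s \<Longrightarrow>
    body_typed r \<Delta> (Call i) T \<alpha>"
| T_tape_Nil: "tape_typed [] []"
| T_tape_Cons: "eam_typed (lookup a) \<beta> \<Longrightarrow> tape_typed T \<beta>s \<Longrightarrow> tape_typed (a # T) (\<beta> # \<beta>s)"


subsection \<open>The logical relation\<close>

definition typed_addrs :: "ty \<Rightarrow> 'a set" where
  "typed_addrs \<alpha> = {a. eam_typed (lookup a) \<alpha>}"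

primrec log_rel :: "ty \<Rightarrow> 'a eam \<Rightarrow> 'a eam \<Rightarrow> bool" where
  "log_rel IntT M N \<longleftrightarrow> (\<forall>n. M \<rightarrow>\<^sub>c* numeral_eam num n \<longleftrightarrow> N \<rightarrow>\<^sub>c* numeral_eam num n)"
| "log_rel (\<alpha> \<rightarrow>\<^sub>t \<beta>) M N \<longleftrightarrow>
    (\<forall>a\<in>typed_addrs \<alpha>. \<forall>b\<in>typed_addrs \<alpha>. log_rel \<alpha> (lookup a) (lookup b) \<longrightarrow>
      log_rel \<beta> (M @@ [a]) (N @@ [b]))"


subsection \<open>The translation\<close>

definition loads :: "nat \<Rightarrow> body \<Rightarrow> program" where
  "loads m A = foldr Load [0..<m] (Body A)"

text \<open>Replaces the content of register \<open>k\<close> by its application to the registers \<open>p, \<dots>, p + n - 1\<close>.\<close>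

definition apps :: "nat \<Rightarrow> nat \<Rightarrow> nat \<Rightarrow> body \<Rightarrow> body" where
  "apps k p n A = foldr (AppI k k) [p..<p + n] A"

text \<open>
  With \<open>a \<cdot> ds\<close> for the iterated application of \<open>a\<close> to the addresses \<open>ds\<close>, of which there are \<open>n\<close>:
  \<open>Pr n i\<close> on input \<open>ds\<close> becomes the machine of the \<open>i\<close>-th one (counting from \<open>0\<close>);
  \<open>Apply n\<close> on \<open>a, b, ds\<close> becomes the machine of \<open>a \<cdot> ds\<close> with \<open>b \<cdot> ds\<close> appended to its tape;
  \<open>Pred_n\<close>, \<open>Succ_n\<close>, \<open>Ifz_n\<close> and \<open>Fix_n\<close> apply each of their first arguments to \<open>ds\<close> and then
  perform the operation, in the last case applying the fixed point machine.
\<close>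

definition Pr :: "nat \<Rightarrow> nat \<Rightarrow> 'a eam" where
  "Pr n i = EAM (replicate n None) (loads n (Call i)) []"

definition Apply_n :: "nat \<Rightarrow> 'a eam" where
  "Apply_n n = EAM (replicate (n + 2) None)
     (loads (n + 2) (apps 0 2 n (apps 1 2 n (AppI 0 0 1 (Call 0))))) []"

definition Pred_n :: "nat \<Rightarrow> 'a eam" where
  "Pred_n n = EAM (replicate (n + 1) None)
     (loads (n + 1) (apps 0 1 n (PredI 0 0 (Call 0)))) []"

definition Succ_n :: "nat \<Rightarrow> 'a eam" where
  "Succ_n n = EAM (replicate (n + 1) None)
     (loads (n + 1) (apps 0 1 n (SuccI 0 0 (Call 0)))) []"

definition Ifz_n :: "nat \<Rightarrow> 'a eam" where
  "Ifz_n n = EAM (replicate (n + 3) None)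
     (loads (n + 3) (apps 0 3 n (apps 1 3 n (apps 2 3 n (TestI 0 0 1 2 (Call 0)))))) []"

definition Fix_n :: "nat \<Rightarrow> 'a eam" where
  "Fix_n n = EAM (replicate (n + 1) None @ [Some y])
     (loads (n + 1) (apps 0 1 n (AppI 0 (n + 1) 0 (Call 0)))) []"

text \<open>
  \<open>translate n P\<close> translates a term with free variables among \<open>x\<^sub>1, \<dots>, x\<^sub>n\<close> to a machine that expects
  their values, in this order, on its tape. A bound variable becomes the new last one, so the
  de Bruijn index \<open>i\<close> stands for \<open>x\<^bsub>n-i\<^esub>\<close>. For terms with explicit substitutions the clause for
  abstraction also appends to the tape the translations of the terms to be substituted; PCF
  terms are those in which all explicit substitutions are empty.
\<close>

primrec translate :: "nat \<Rightarrow> pcf \<Rightarrow> 'a eam" where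
  "translate n (Var i) = Pr n (n - 1 - i)"
| "translate n (Lam P) = translate (Suc n) P"
| "translate n (App P Q) = Apply_n n @@ [addr (translate n P), addr (translate n Q)]"
| "translate n (Fix P) = Fix_n n @@ [addr (translate n P)]"
| "translate n Zero = Pr (n + 1) 0 @@ [num 0]"
| "translate n (Pred P) = Pred_n n @@ [addr (translate n P)]"
| "translate n (Succ P) = Succ_n n @@ [addr (translate n P)]"
| "translate n (Ifz L P Q) = Ifz_n n @@ [addr (translate n L), addr (translate n P), addr (translate n Q)]"

definition Tr :: "pcf \<Rightarrow> 'a eam" where
  "Tr P = translate 0 P"

end

end

theory Submission
  imports Defs
begin

text \<open>
  Machines and programs are compared by a relation indexed by types: at \<open>IntT\<close> they have the same
  values, at function types they map related arguments to related results. Every program is related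
  to its translation, and every typed machine to some program, read off its typing derivation as a
  function of the contents of its registers. So the arguments of a typed machine may be replaced by
  programs; then the logical relation on machines amounts to being related to the same programs,
  and observationally equivalent programs are related to the same machines.

  Because of the fixed point machine, both facts are proved for two step-indexed relations, one for
  each direction of the equivalence of values; the index bounds the steps of the side that is assumed
  to terminate. Definability, which holds on both sides, allows to pass from the relation without
  indices back to the indexed ones.
\<close>

text \<open>The obstacle is recursion. The machine \<open>Y_eam y\<close> on input \<open>a\<close>
  and the term \<open>Fix Q\<close> unfold to expressions that contain them again, so neither the
  type nor the derivation gets smaller, and a relation without indices gives no induction. Machine
  and term need different numbers of steps for the same computation, hence one count cannot bound
  both sides. Counting one side leaves the other free to run as long as it likes, and having both
  directions recovers equality of values. The price appears at function types: an indexed relation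
  must accept arguments that agree in one direction only and up to a bound, whereas the logical
  relation on machines has arguments with exactly the same values. The gap is closed by exchanging
  machines or programs that share a common partner, and these partners are supplied by definability
  for machines and by the translation for programs. Since every argument in the logical relation has
  a defining program, applying the two given programs to programs is test enough, so of all contexts
  only the applicative ones occur.\<close>

lemma relpowp_deterministic_prefix:
  assumes det: "\<And>x y z. r x y \<Longrightarrow> r x z \<Longrightarrow> y = z" and nf: "\<And>y. \<not> r v y"
    and "(r ^^ i) x x'" "(r ^^ j) x v"
  shows "i \<le> j \<and> (r ^^ (j - i)) x' v"
  using assms(3,4)
proof (induction i arbitrary: x j)
  case (Suc i)
  from Suc.prems(1) obtain z where z: "r x z" "(r ^^ i) z x'"
    using relpowp_Suc_D2 by metis
  with nf Suc.prems(2) obtain j' where j: "j = Suc j'"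
    by (cases j) auto
  with Suc.prems(2) obtain z' where z': "r x z'" "(r ^^ j') z' v"
    using relpowp_Suc_D2 by metis
  with z det have "z' = z" by blast
  with Suc.IH[OF z(2)] z' j show ?case by simp
qed simp

section \<open>PCF\<close>

inductive_cases Lam_stepE: "Lam P \<rightarrow>\<^sub>P Q"
inductive_cases Zero_stepE: "Zero \<rightarrow>\<^sub>P P"
inductive_cases App_stepE: "App P Q \<rightarrow>\<^sub>P R"
inductive_cases Fix_stepE: "Fix P \<rightarrow>\<^sub>P Q"
inductive_cases Pred_stepE: "Pred P \<rightarrow>\<^sub>P Q"
inductive_cases Succ_stepE: "Succ P \<rightarrow>\<^sub>P Q"
inductive_cases Ifz_stepE: "Ifz L P Q \<rightarrow>\<^sub>P R"

lemma numeral_pcf_no_step: "\<not> numeral_pcf n \<rightarrow>\<^sub>P P"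
  by (induction n arbitrary: P) (auto elim: Zero_stepE Succ_stepE)

lemma Zero_no_step: "\<not> Zero \<rightarrow>\<^sub>P P"
  using numeral_pcf_no_step[of 0] by simp

lemma Succ_numeral_no_step: "\<not> Succ (numeral_pcf n) \<rightarrow>\<^sub>P P"
  using numeral_pcf_no_step[of "Suc n"] by simp

lemma numeral_pcf_inject [simp]: "numeral_pcf m = numeral_pcf n \<longleftrightarrow> m = n"
proof (induction m arbitrary: n)
  case 0 show ?case by (cases n) auto
next
  case (Suc m) then show ?case by (cases n) auto
qed

lemma pcf_step_deterministic: "P \<rightarrow>\<^sub>P Q \<Longrightarrow> P \<rightarrow>\<^sub>P Q' \<Longrightarrow> Q = Q'"
proof (induction arbitrary: Q' rule: pcf_step.induct)
  case (beta P Q)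
  then show ?case by (auto elim: App_stepE Lam_stepE)
next
  case (unfold_fix P)
  then show ?case by (auto elim: Fix_stepE)
next
  case pred_zero
  then show ?case by (elim Pred_stepE) (auto simp: Zero_no_step)
next
  case (pred_succ n)
  then show ?case by (elim Pred_stepE) (auto simp: Succ_numeral_no_step)
next
  case (ifz_zero P Q)
  then show ?case by (elim Ifz_stepE) (auto simp: Zero_no_step)
next
  case (ifz_succ n P Q)
  then show ?case by (elim Ifz_stepE) (auto simp: Succ_numeral_no_step)
next
  case (ctx_app P P' Q)
  from ctx_app.prems show ?case
    by (rule App_stepE) (use ctx_app.hyps ctx_app.IH in \<open>blast elim: Lam_stepE\<close>)+
next
  case (ctx_pred P P')
  from ctx_pred.prems show ?case
    by (rule Pred_stepE) (use ctx_pred.hyps ctx_pred.IH Zero_no_step Succ_numeral_no_step in blast)+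
next
  case (ctx_succ P P')
  from ctx_succ.prems show ?case
    by (rule Succ_stepE) (use ctx_succ.hyps ctx_succ.IH in blast)+
next
  case (ctx_ifz L L' P Q)
  from ctx_ifz.prems show ?case
    by (rule Ifz_stepE) (use ctx_ifz.hyps ctx_ifz.IH Zero_no_step Succ_numeral_no_step in blast)+
qed

text \<open>The exact number of remaining steps matters, not only that the reduct reaches the same
  numeral: the indices of the relations below are bounds on such numbers.\<close>

lemma pcf_prefix:
  "(pcf_step ^^ i) P P' \<Longrightarrow> (pcf_step ^^ j) P (numeral_pcf n) \<Longrightarrow>
    i \<le> j \<and> (pcf_step ^^ (j - i)) P' (numeral_pcf n)"
  by (rule relpowp_deterministic_prefix) (use pcf_step_deterministic numeral_pcf_no_step in blast)+

lemma pcf_steps_numeral_unique: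
  "P \<rightarrow>\<^sub>P* numeral_pcf m \<Longrightarrow> P \<rightarrow>\<^sub>P* numeral_pcf n \<Longrightarrow> m = n"
proof -
  assume "P \<rightarrow>\<^sub>P* numeral_pcf m" "P \<rightarrow>\<^sub>P* numeral_pcf n"
  then obtain i j where "(pcf_step ^^ i) P (numeral_pcf m)" "(pcf_step ^^ j) P (numeral_pcf n)"
    by (metis rtranclp_imp_relpowp)
  from pcf_prefix[OF this] numeral_pcf_no_step show "m = n"
    by (metis relpowp_E2 numeral_pcf_inject)
qed

lemma steps_map:
  assumes "\<And>x y. r x y \<Longrightarrow> s (f x) (f y)" "r\<^sup>*\<^sup>* x y"
  shows "s\<^sup>*\<^sup>* (f x) (f y)"
  using assms(2) by induction (auto intro: rtranclp.rtrancl_into_rtrancl assms(1))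

lemma foldl_App_step: "P \<rightarrow>\<^sub>P P' \<Longrightarrow> foldl App P Qs \<rightarrow>\<^sub>P foldl App P' Qs"
  by (induction Qs arbitrary: P P') (auto intro: pcf_step.intros)

lemma Pred_numeral_steps: "P \<rightarrow>\<^sub>P* numeral_pcf n \<Longrightarrow> Pred P \<rightarrow>\<^sub>P* numeral_pcf (n - 1)"
proof -
  assume "P \<rightarrow>\<^sub>P* numeral_pcf n"
  then have "Pred P \<rightarrow>\<^sub>P* Pred (numeral_pcf n)"
    by (rule steps_map[of pcf_step pcf_step Pred, rotated]) (rule ctx_pred)
  moreover have "Pred (numeral_pcf n) \<rightarrow>\<^sub>P numeral_pcf (n - 1)"
    using pred_zero pred_succ by (cases n) auto
  ultimately show ?thesis by auto
qed

lemma Succ_numeral_steps: "P \<rightarrow>\<^sub>P* numeral_pcf n \<Longrightarrow> Succ P \<rightarrow>\<^sub>P* numeral_pcf (n + 1)"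
  using steps_map[of pcf_step pcf_step Succ P "numeral_pcf n"] ctx_succ by auto

lemma Ifz_numeral_steps:
  assumes "L \<rightarrow>\<^sub>P* numeral_pcf n"
  shows "Ifz L P Q \<rightarrow>\<^sub>P* (if n = 0 then P else Q)"
proof -
  have "Ifz L P Q \<rightarrow>\<^sub>P* Ifz (numeral_pcf n) P Q"
    using assms by (rule steps_map[of pcf_step pcf_step "\<lambda>L. Ifz L P Q", rotated]) (rule ctx_ifz)
  moreover have "Ifz (numeral_pcf n) P Q \<rightarrow>\<^sub>P (if n = 0 then P else Q)"
    using ifz_zero ifz_succ by (cases n) auto
  ultimately show ?thesis by auto
qed

section \<open>Terms that evaluate a subterm first\<close>

lemma foldl_App_not_numeral: "P \<noteq> foldl App (App Q R) Qs" if "P = numeral_pcf n" for P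
proof -
  have "\<exists>P Q'. foldl App (App Q R) Qs = App P Q'"
    by (induction Qs rule: rev_induct) auto
  moreover have "P \<noteq> App P' Q'" for P' Q'
    using that by (cases n) auto
  ultimately show ?thesis by metis
qed

text \<open>Only a \<open>Lam\<close> in function position can be contracted. A head that is no
  \<open>Lam\<close> does not become one by being applied, so the step descends along the spine to
  the head.\<close>

lemma foldl_App_step_head:
  assumes "foldl App P Qs \<rightarrow>\<^sub>P X" "\<And>B. P \<noteq> Lam B"
  shows "\<exists>P'. P \<rightarrow>\<^sub>P P' \<and> X = foldl App P' Qs"
  using assms(1)
proof (induction Qs arbitrary: X rule: rev_induct)
  case (snoc Q Qs)
  have "foldl App P Qs \<noteq> Lam B" for B
    using assms(2) by (cases Qs rule: rev_cases) auto
  with snoc.prems obtain Y where "foldl App P Qs \<rightarrow>\<^sub>P Y" "X = App Y Q"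
    by (auto elim: App_stepE)
  with snoc.IH show ?case by fastforce
qed simp

text \<open>The term \<open>F L\<close> is \<open>Ifz L P Q\<close>, \<open>Pred L\<close> or \<open>Succ L\<close>.\<close>

lemma strict_halts:
  assumes "\<And>L B. F L \<noteq> Lam B"
    and "\<And>L X. F L \<rightarrow>\<^sub>P X \<Longrightarrow> (\<exists>L'. L \<rightarrow>\<^sub>P L' \<and> X = F L') \<or> (\<exists>n. L = numeral_pcf n)"
    and "\<And>L m. F L = numeral_pcf m \<Longrightarrow> \<exists>n. L = numeral_pcf n"
    and "(pcf_step ^^ j) (foldl App (F L) Qs) (numeral_pcf m)"
  shows "\<exists>i\<le>j. \<exists>n. (pcf_step ^^ i) L (numeral_pcf n)"
  using assms(4)
proof (induction j arbitrary: L)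
  case 0
  \<comment> \<open>With no steps left the spine is itself a numeral, hence no application, so
    \<open>Qs\<close> is empty. Of the three instances only \<open>Succ\<close> can be a numeral,
    and then its argument is one.\<close>
  then have *: "foldl App (F L) Qs = numeral_pcf m" by simp
  then have "Qs = []"
    using foldl_App_not_numeral[OF refl] by (cases Qs) (simp, metis foldl_Cons)
  with * assms(3) show ?case by force
next
  case (Suc j)
  from relpowp_Suc_D2[OF Suc.prems] obtain X where
    "foldl App (F L) Qs \<rightarrow>\<^sub>P X" "(pcf_step ^^ j) X (numeral_pcf m)" by auto
  with foldl_App_step_head assms(1) obtain Y where
    Y: "F L \<rightarrow>\<^sub>P Y" "(pcf_step ^^ j) (foldl App Y Qs) (numeral_pcf m)" by blast
  from assms(2)[OF Y(1)] show ?case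
  proof
    assume "\<exists>L'. L \<rightarrow>\<^sub>P L' \<and> Y = F L'"
    then obtain L' where "L \<rightarrow>\<^sub>P L'" "Y = F L'" by blast
    with Suc.IH Y(2) show ?case by (metis Suc_le_mono relpowp_Suc_I2)
  next
    assume "\<exists>n. L = numeral_pcf n"
    then show ?case by (metis le0 relpowp_0_I)
  qed
qed

text \<open>Arbitrary arguments give the notion a meaning at function types: where it fails,
  \<open>P\<close> cannot be told from a diverging term within \<open>k\<close> steps. Nothing is
  typed, since only the shape of the run matters.\<close>

definition pcf_halts :: "nat \<Rightarrow> pcf \<Rightarrow> bool" where
  "pcf_halts k P \<longleftrightarrow> (\<exists>j\<le>k. \<exists>Qs m. (pcf_step ^^ j) (foldl App P Qs) (numeral_pcf m))"

lemma pcf_halts_mono: "pcf_halts j P \<Longrightarrow> j \<le> k \<Longrightarrow> pcf_halts k P"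
  unfolding pcf_halts_def using order_trans by blast

lemma pcf_halts_App: "pcf_halts k (App P Q) \<Longrightarrow> pcf_halts k P"
  unfolding pcf_halts_def by (metis foldl_Cons)

lemma ex_numeral: "\<exists>n. Zero = numeral_pcf n" "\<exists>m. Succ (numeral_pcf n) = numeral_pcf m"
  by (metis numeral_pcf.simps(1), metis numeral_pcf.simps(2))

lemma pcf_halts_Ifz:
  assumes "pcf_halts k (Ifz L P Q)"
  shows "\<exists>i\<le>k. \<exists>n. (pcf_step ^^ i) L (numeral_pcf n)"
proof -
  have "\<exists>n. L = numeral_pcf n" if "Ifz L P Q = numeral_pcf m" for L m
    using that by (cases m) auto
  moreover have "(\<exists>L'. L \<rightarrow>\<^sub>P L' \<and> X = Ifz L' P Q) \<or> (\<exists>n. L = numeral_pcf n)"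
    if "Ifz L P Q \<rightarrow>\<^sub>P X" for L X
    using that by (elim Ifz_stepE) (auto simp: ex_numeral)
  moreover from assms obtain j Qs m where "j \<le> k" "(pcf_step ^^ j) (foldl App (Ifz L P Q) Qs) (numeral_pcf m)"
    unfolding pcf_halts_def by blast
  moreover have "Ifz L P Q \<noteq> Lam B" for L B by simp
  ultimately have "\<exists>i\<le>j. \<exists>n. (pcf_step ^^ i) L (numeral_pcf n)"
    by (intro strict_halts[of "\<lambda>L. Ifz L P Q" j L Qs m]) blast+
  with \<open>j \<le> k\<close> show ?thesis by (meson order_trans)
qed

lemma pcf_halts_Pred:
  assumes "pcf_halts k (Pred L)"
  shows "\<exists>i\<le>k. \<exists>n. (pcf_step ^^ i) L (numeral_pcf n)"
proof -
  have "\<exists>n. L = numeral_pcf n" if "Pred L = numeral_pcf m" for L m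
    using that by (cases m) auto
  moreover have "(\<exists>L'. L \<rightarrow>\<^sub>P L' \<and> X = Pred L') \<or> (\<exists>n. L = numeral_pcf n)"
    if "Pred L \<rightarrow>\<^sub>P X" for L X
    using that by (elim Pred_stepE) (auto simp: ex_numeral)
  moreover from assms obtain j Qs m where "j \<le> k" "(pcf_step ^^ j) (foldl App (Pred L) Qs) (numeral_pcf m)"
    unfolding pcf_halts_def by blast
  moreover have "Pred L \<noteq> Lam B" for L B by simp
  ultimately have "\<exists>i\<le>j. \<exists>n. (pcf_step ^^ i) L (numeral_pcf n)"
    by (intro strict_halts[of Pred j L Qs m]) blast+
  with \<open>j \<le> k\<close> show ?thesis by (meson order_trans)
qed

lemma pcf_halts_Succ:
  assumes "pcf_halts k (Succ L)"
  shows "\<exists>i\<le>k. \<exists>n. (pcf_step ^^ i) L (numeral_pcf n)"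
proof -
  have "\<exists>n. L = numeral_pcf n" if "Succ L = numeral_pcf m" for L m
    using that by (cases m) auto
  moreover have "(\<exists>L'. L \<rightarrow>\<^sub>P L' \<and> X = Succ L') \<or> (\<exists>n. L = numeral_pcf n)"
    if "Succ L \<rightarrow>\<^sub>P X" for L X
    using that by (elim Succ_stepE) auto
  moreover from assms obtain j Qs m where "j \<le> k" "(pcf_step ^^ j) (foldl App (Succ L) Qs) (numeral_pcf m)"
    unfolding pcf_halts_def by blast
  moreover have "Succ L \<noteq> Lam B" for L B by simp
  ultimately have "\<exists>i\<le>j. \<exists>n. (pcf_step ^^ i) L (numeral_pcf n)"
    by (intro strict_halts[of Succ j L Qs m]) blast+
  with \<open>j \<le> k\<close> show ?thesis by (meson order_trans)
qed

section \<open>Typing and substitution of closed terms\<close>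

lemma pcf_typed_closed:
  "pcf_typed \<Gamma> P \<alpha> \<Longrightarrow> length \<Gamma> \<le> k \<Longrightarrow> lift k P = P \<and> subst k N P = P"
  by (induction arbitrary: k N rule: pcf_typed.induct) auto

lemma program_closed [simp]:
  assumes "pcf_program P \<alpha>"
  shows "lift k P = P" "subst k N P = P"
  using pcf_typed_closed[OF assms, of k N] by auto

lemma pcf_typed_weaken: "pcf_typed \<Gamma> P \<alpha> \<Longrightarrow> pcf_typed (\<Gamma> @ \<Gamma>') P \<alpha>"
proof (induction rule: pcf_typed.induct)
  case (1 i \<Gamma>)
  then show ?case
    using pcf_typed.intros(1)[of i "\<Gamma> @ \<Gamma>'"] by (simp add: nth_append)
qed (auto intro: pcf_typed.intros)

lemma program_typed_any: "pcf_program P \<alpha> \<Longrightarrow> pcf_typed \<Gamma> P \<alpha>"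
  using pcf_typed_weaken[of "[]" P \<alpha> \<Gamma>] by simp

text \<open>Substitution of closed terms suffices for programs under weak head reduction. Lifting
  such a term under a binder does nothing, and it keeps its type in every environment, so no lemma
  about lifting is required.\<close>

lemma pcf_typed_subst:
  "pcf_typed (\<Gamma> @ \<tau> # \<Gamma>') P \<alpha> \<Longrightarrow> pcf_program N \<tau> \<Longrightarrow> pcf_typed (\<Gamma> @ \<Gamma>') (subst (length \<Gamma>) N P) \<alpha>"
proof (induction "\<Gamma> @ \<tau> # \<Gamma>'" P \<alpha> arbitrary: \<Gamma> rule: pcf_typed.induct)
  case (1 i)
  show ?case
  proof (cases "i = length \<Gamma>")
    case True
    with 1 show ?thesis by (simp add: program_typed_any)
  next
    case False
    let ?j = "if i < length \<Gamma> then i else i - 1"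
    have "?j < length (\<Gamma> @ \<Gamma>')" "(\<Gamma> @ \<Gamma>') ! ?j = (\<Gamma> @ \<tau> # \<Gamma>') ! i"
      using False 1(1) by (auto simp: nth_append nth_Cons')
    moreover have "subst (length \<Gamma>) N (Var i) = Var ?j"
      using False by simp
    ultimately show ?thesis
      using pcf_typed.intros(1)[of ?j "\<Gamma> @ \<Gamma>'"] by (simp only:)
  qed
next
  case (3 \<beta> P \<gamma>)
  from 3(2)[of "\<beta> # \<Gamma>"] 3(3) show ?case by (auto intro: pcf_typed.intros)
qed (auto intro: pcf_typed.intros)

text \<open>
  \<open>msubst c Qs P\<close> replaces the variables \<open>c + length Qs - 1, \<dots>, c\<close> by the closed terms \<open>Qs\<close>, in this
  order: the head of \<open>Qs\<close> goes to the variable that was bound first.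
\<close>

primrec msubst :: "nat \<Rightarrow> pcf list \<Rightarrow> pcf \<Rightarrow> pcf" where
  "msubst c [] P = P"
| "msubst c (Q # Qs) P = msubst c Qs (subst (c + length Qs) Q P)"

definition programs :: "ty list \<Rightarrow> pcf list \<Rightarrow> bool" where
  "programs \<tau>s Qs \<longleftrightarrow> list_all2 (\<lambda>\<tau> Q. pcf_program Q \<tau>) \<tau>s Qs"

lemma programs_simps [simp]:
  "programs [] Qs \<longleftrightarrow> Qs = []"
  "programs (\<tau> # \<tau>s) [] \<longleftrightarrow> False"
  "programs (\<tau> # \<tau>s) (Q # Qs) \<longleftrightarrow> pcf_program Q \<tau> \<and> programs \<tau>s Qs"
  by (auto simp: programs_def)

lemma programs_length: "programs \<tau>s Qs \<Longrightarrow> length Qs = length \<tau>s"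
  by (auto simp: programs_def list_all2_lengthD)

lemma programs_induct [consumes 1, case_names Nil Cons]:
  assumes "programs \<tau>s Qs" "R [] []"
    and "\<And>\<tau> \<tau>s Q Qs. pcf_program Q \<tau> \<Longrightarrow> programs \<tau>s Qs \<Longrightarrow> R \<tau>s Qs \<Longrightarrow> R (\<tau> # \<tau>s) (Q # Qs)"
  shows "R \<tau>s Qs"
  using assms(1) unfolding programs_def
  by (induction rule: list_all2_induct) (use assms(2,3) in \<open>auto simp: programs_def\<close>)

lemma msubst_simps [simp]:
  "msubst c Qs (App P Q) = App (msubst c Qs P) (msubst c Qs Q)"
  "msubst c Qs (Fix P) = Fix (msubst c Qs P)"
  "msubst c Qs Zero = Zero"
  "msubst c Qs (Pred P) = Pred (msubst c Qs P)"
  "msubst c Qs (Succ P) = Succ (msubst c Qs P)"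
  "msubst c Qs (Ifz L P Q) = Ifz (msubst c Qs L) (msubst c Qs P) (msubst c Qs Q)"
  by (induction Qs arbitrary: L P Q) auto

lemma msubst_Lam: "programs \<tau>s Qs \<Longrightarrow> msubst c Qs (Lam P) = Lam (msubst (Suc c) Qs P)"
  by (induction arbitrary: P rule: programs_induct) auto

text \<open>This is the shape produced by a beta step: the variable bound last is the innermost one
  and corresponds to the end of the list.\<close>

lemma msubst_append: "msubst c (Qs @ [Q]) P = subst c Q (msubst (Suc c) Qs P)"
  by (induction Qs arbitrary: P) auto

lemma msubst_program [simp]: "pcf_program P \<alpha> \<Longrightarrow> msubst c Qs P = P"
  by (induction Qs) auto

lemma msubst_foldl [simp]: "msubst c Qs (foldl App P Ps) = foldl App (msubst c Qs P) (map (msubst c Qs) Ps)"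
  by (induction Ps arbitrary: P) auto

lemma msubst_Var:
  "programs \<tau>s Qs \<Longrightarrow> i < length Qs \<Longrightarrow> msubst 0 Qs (Var (length Qs - 1 - i)) = Qs ! i"
proof (induction arbitrary: i rule: programs_induct)
  case (Cons \<tau> \<tau>s Q Qs)
  then show ?case
    by (cases i) auto
qed simp

lemma msubst_typed:
  "programs \<tau>s Qs \<Longrightarrow> pcf_typed (rev \<tau>s) P \<alpha> \<Longrightarrow> pcf_program (msubst 0 Qs P) \<alpha>"
proof (induction arbitrary: P rule: programs_induct)
  case (Cons \<tau> \<tau>s Q Qs)
  from pcf_typed_subst[of "rev \<tau>s" \<tau> "[]" P \<alpha> Q] Cons show ?case
    by (auto simp: programs_length)
qed simp

lemma subst_lams: "pcf_program Q \<tau> \<Longrightarrow> subst c Q ((Lam ^^ n) B) = (Lam ^^ n) (subst (c + n) Q B)"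
  by (induction n arbitrary: c) auto

lemma lams_steps: "programs \<tau>s Qs \<Longrightarrow> foldl App ((Lam ^^ length \<tau>s) B) Qs \<rightarrow>\<^sub>P* msubst 0 Qs B"
proof (induction arbitrary: B rule: programs_induct)
  case (Cons \<tau> \<tau>s Q Qs)
  have "App ((Lam ^^ length (\<tau> # \<tau>s)) B) Q \<rightarrow>\<^sub>P (Lam ^^ length \<tau>s) (subst (length \<tau>s) Q B)"
    using beta[of "(Lam ^^ length \<tau>s) B" Q] subst_lams[OF Cons(1), of 0] by simp
  from foldl_App_step[OF this] Cons.IH[of "subst (length \<tau>s) Q B"]
  show ?case
    using programs_length[OF Cons(2)] by (auto intro: converse_rtranclp_into_rtranclp)
qed simp

lemma lams_typed:
  "pcf_typed (rev \<tau>s @ \<Gamma>) B \<alpha> \<Longrightarrow> pcf_typed \<Gamma> ((Lam ^^ length \<tau>s) B) (foldr (\<rightarrow>\<^sub>t) \<tau>s \<alpha>)"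
  by (induction \<tau>s arbitrary: \<Gamma>) (auto intro: pcf_typed.intros)

lemma foldl_App_typed:
  "pcf_typed \<Gamma> P (foldr (\<rightarrow>\<^sub>t) \<tau>s \<alpha>) \<Longrightarrow> list_all2 (\<lambda>\<tau> Q. pcf_typed \<Gamma> Q \<tau>) \<tau>s Qs
    \<Longrightarrow> pcf_typed \<Gamma> (foldl App P Qs) \<alpha>"
proof (induction \<tau>s arbitrary: P Qs)
  case (Cons \<tau> \<tau>s)
  then obtain Q Qs' where "Qs = Q # Qs'" "pcf_typed \<Gamma> Q \<tau>" "list_all2 (\<lambda>\<tau> Q. pcf_typed \<Gamma> Q \<tau>) \<tau>s Qs'"
    by (auto simp: list_all2_Cons1)
  with Cons.IH[of "App P Q" Qs'] Cons.prems(1) pcf_typed.intros(2) show ?case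
    by auto
qed simp

lemma programs_foldl_App:
  "pcf_program P (foldr (\<rightarrow>\<^sub>t) \<tau>s \<alpha>) \<Longrightarrow> programs \<tau>s Qs \<Longrightarrow> pcf_program (foldl App P Qs) \<alpha>"
  unfolding programs_def by (rule foldl_App_typed)

lemma Var_typed: "i < length \<tau>s \<Longrightarrow> pcf_typed (rev \<tau>s) (Var (length \<tau>s - 1 - i)) (\<tau>s ! i)"
  using pcf_typed.intros(1)[of "length \<tau>s - 1 - i" "rev \<tau>s"] by (simp add: rev_nth)

lemma numeral_pcf_typed: "pcf_typed \<Gamma> (numeral_pcf n) IntT"
  by (induction n) (auto intro: pcf_typed.intros)


section \<open>Machines\<close>

definition strict_at :: "nat \<Rightarrow> body \<Rightarrow> bool" where
  "strict_at i I \<longleftrightarrow> (\<exists>k A. I = PredI k i A) \<or> (\<exists>k A. I = SuccI k i A) \<or> (\<exists>l j k A. I = TestI l i j k A)"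

lemma strict_at_simps [simp]:
  "strict_at i (PredI k i A)" "strict_at i (SuccI k i A)" "strict_at i (TestI l i j k A)"
  by (auto simp: strict_at_def)

lemma append_tape_simps [simp]:
  "EAM R P T @@ as = EAM R P (T @ as)" "M @@ [] = M" "M @@ as @@ bs = M @@ (as @ bs)"
  "regs (M @@ as) = regs M" "prog (M @@ as) = prog M"
  by (auto simp: append_tape_def)

lemma append_tape_machines [simp]: "M @@ as \<in> machines \<longleftrightarrow> M \<in> machines"
  by (simp add: machines_def)

lemma reads_unique: "reads R i a \<Longrightarrow> reads R i b \<Longrightarrow> a = b"
  by (simp add: reads_def)

lemma reads_update: "reads R i a \<Longrightarrow> reads (R[i := Some b]) i b"
  by (simp add: reads_def)

definition initialised :: "'a option list \<Rightarrow> nat set" where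
  "initialised R = {i. i < length R \<and> R ! i \<noteq> None}"

lemma initialised_update: "initialised (R[k := Some a]) = initialise (length R) (initialised R) k"
  by (auto simp: initialised_def initialise_def nth_list_update)

lemma initialise_initialised [simp]:
  "i \<in> initialised R \<Longrightarrow> initialise (length R) (initialised R) i = initialised R"
  by (auto simp: initialised_def initialise_def)

lemma machines_EAM: "EAM R P T \<in> machines \<longleftrightarrow> valid_program (length R) (initialised R) P"
  by (simp add: machines_def initialised_def)

lemma numeral_eam_machines: "numeral_eam num n \<in> machines"
  by (simp add: machines_EAM numeral_eam_def)

lemma Y_eam_machines: "Y_eam a \<in> machines"
proof -
  have "initialised [None, Some a] = {1}"
    by (auto simp: initialised_def nth_Cons')
  then show ?thesis
    by (auto simp: machines_EAM Y_eam_def initialise_def)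
qed

context address_map
begin

lemma lookup_machines [simp]: "lookup a \<in> machines"
  unfolding lookup_def using bij_addr
  by (metis UNIV_I bij_betw_def the_inv_into_into subset_refl)

lemma addr_lookup [simp]: "addr (lookup a) = a"
  unfolding lookup_def using bij_addr by (metis UNIV_I f_the_inv_into_f_bij_betw)

lemma lookup_addr: "M \<in> machines \<Longrightarrow> lookup (addr M) = M"
  unfolding lookup_def using bij_addr by (metis bij_betw_def the_inv_into_f_f)

lemma lookup_dot [simp]: "lookup (dot a b) = lookup a @@ [b]"
  by (simp add: dot_def lookup_addr)

lemma lookup_num [simp]: "lookup (num n) = numeral_eam num n"
  by (metis addr_numeral lookup_addr numeral_eam_machines)

lemma lookup_y [simp]: "lookup y = Y_eam y"
  by (metis addr_Y lookup_addr Y_eam_machines)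

lemma numeral_eam_inject [simp]: "numeral_eam num m = numeral_eam num n \<longleftrightarrow> m = n"
  using inj_num by (auto simp: numeral_eam_def inj_def)

section \<open>Determinism and validity of machine reduction\<close>

inductive_cases Load_stepE: "EAM R (Load i P) T \<rightarrow>\<^sub>c M"
inductive_cases Eps_stepE: "EAM R (Body Eps) T \<rightarrow>\<^sub>c M"
inductive_cases Call_stepE: "EAM R (Body (Call i)) T \<rightarrow>\<^sub>c M"
inductive_cases AppI_stepE: "EAM R (Body (AppI k i j A)) T \<rightarrow>\<^sub>c M"
inductive_cases PredI_stepE: "EAM R (Body (PredI k i A)) T \<rightarrow>\<^sub>c M"
inductive_cases SuccI_stepE: "EAM R (Body (SuccI k i A)) T \<rightarrow>\<^sub>c M"
inductive_cases TestI_stepE: "EAM R (Body (TestI l i j k A)) T \<rightarrow>\<^sub>c M"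

lemma numeral_eam_no_step: "\<not> numeral_eam num n \<rightarrow>\<^sub>c M"
  unfolding numeral_eam_def by (auto elim: Eps_stepE)

text \<open>The rules for one instruction exclude each other: the register holds either a numeral
  machine, which is stuck, or a machine that reduces, and by induction does so in one way.\<close>

lemma step_deterministic: "M \<rightarrow>\<^sub>c N \<Longrightarrow> M \<rightarrow>\<^sub>c N' \<Longrightarrow> N = N'"
proof (induction arbitrary: N' rule: step.induct)
  case (Load R i P a T)
  from Load.prems show ?case by (rule Load_stepE) auto
next
  case (Call R i a T)
  from Call.prems show ?case by (rule Call_stepE) (use Call.hyps in \<open>auto dest: reads_unique\<close>)
next
  case (App R i a j b k A T)
  from App.prems show ?case by (rule AppI_stepE) (use App.hyps in \<open>auto dest: reads_unique\<close>)
next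
  case (Pred R i a n k A T)
  from Pred.prems show ?case
  proof (rule PredI_stepE, goal_cases)
    case (1 b m)
    then have "m = n" using Pred.hyps by (metis reads_unique numeral_eam_inject)
    with 1 show ?case by simp
  next
    case (2 b M)
    then show ?case using Pred.hyps by (metis reads_unique numeral_eam_no_step)
  qed
next
  case (Succ R i a n k A T)
  from Succ.prems show ?case
  proof (rule SuccI_stepE, goal_cases)
    case (1 b m)
    then have "m = n" using Succ.hyps by (metis reads_unique numeral_eam_inject)
    with 1 show ?case by simp
  next
    case (2 b M)
    then show ?case using Succ.hyps by (metis reads_unique numeral_eam_no_step)
  qed
next
  case (Test_zero R i a j b l k A T)
  from Test_zero.prems show ?case
  proof (rule TestI_stepE, goal_cases)
    case (1 a' b')
    then have "b' = b" using Test_zero.hyps by (metis reads_unique)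
    with 1 show ?case by simp
  next
    case (2 a' n c)
    then show ?case using Test_zero.hyps by (metis reads_unique numeral_eam_inject nat.distinct(1))
  next
    case (3 a' M)
    then show ?case using Test_zero.hyps by (metis reads_unique numeral_eam_no_step)
  qed
next
  case (Test_succ R i a n k c l j A T)
  from Test_succ.prems show ?case
  proof (rule TestI_stepE, goal_cases)
    case (1 a' b')
    then show ?case using Test_succ.hyps by (metis reads_unique numeral_eam_inject nat.distinct(1))
  next
    case (2 a' n c')
    then have "c' = c" using Test_succ.hyps by (metis reads_unique)
    with 2 show ?case by simp
  next
    case (3 a' M)
    then show ?case using Test_succ.hyps by (metis reads_unique numeral_eam_no_step)
  qed
next
  case (Pred_arg R i a M k A T)
  from Pred_arg.prems show ?case
  proof (rule PredI_stepE, goal_cases)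
    case (1 b m)
    then show ?case using Pred_arg.hyps by (metis reads_unique numeral_eam_no_step)
  next
    case (2 b M')
    then have "M = M'" using Pred_arg.hyps Pred_arg.IH by (metis reads_unique)
    with 2 show ?case by simp
  qed
next
  case (Succ_arg R i a M k A T)
  from Succ_arg.prems show ?case
  proof (rule SuccI_stepE, goal_cases)
    case (1 b m)
    then show ?case using Succ_arg.hyps by (metis reads_unique numeral_eam_no_step)
  next
    case (2 b M')
    then have "M = M'" using Succ_arg.hyps Succ_arg.IH by (metis reads_unique)
    with 2 show ?case by simp
  qed
next
  case (Test_arg R i a M l j k A T)
  from Test_arg.prems show ?case
  proof (rule TestI_stepE, goal_cases)
    case (1 a' b')
    then show ?case using Test_arg.hyps by (metis reads_unique numeral_eam_no_step)
  next
    case (2 a' n c')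
    then show ?case using Test_arg.hyps by (metis reads_unique numeral_eam_no_step)
  next
    case (3 a' M')
    then have "M = M'" using Test_arg.hyps Test_arg.IH by (metis reads_unique)
    with 3 show ?case by simp
  qed
qed

text \<open>Reduction consumes the tape from the front only, so further input at the end does not
  disturb it.\<close>

lemma step_append: "M \<rightarrow>\<^sub>c M' \<Longrightarrow> M @@ as \<rightarrow>\<^sub>c M' @@ as"
  by (induction rule: step.induct) (auto intro: step.intros step.intros[simplified])

lemma steps_append: "M \<rightarrow>\<^sub>c* M' \<Longrightarrow> M @@ as \<rightarrow>\<^sub>c* M' @@ as"
  by (rule steps_map[of step]) (rule step_append)

text \<open>Needed because a strict instruction stores the address of a reduct, from which
  \<open>lookup\<close> recovers the reduct only if it is a valid machine. The overwritten register
  was initialised already, so validity is kept.\<close>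

lemma step_machines: "M \<rightarrow>\<^sub>c M' \<Longrightarrow> M \<in> machines \<Longrightarrow> M' \<in> machines"
  by (cases rule: step.cases)
    (auto simp: machines_EAM initialised_update)

lemma steps_machines: "M \<rightarrow>\<^sub>c* M' \<Longrightarrow> M \<in> machines \<Longrightarrow> M' \<in> machines"
  by (induction rule: rtranclp_induct) (auto intro: step_machines)

lemma step_prefix:
  "(step ^^ i) M M' \<Longrightarrow> (step ^^ j) M (numeral_eam num n) \<Longrightarrow>
    i \<le> j \<and> (step ^^ (j - i)) M' (numeral_eam num n)"
  by (rule relpowp_deterministic_prefix) (use step_deterministic numeral_eam_no_step in blast)+

text \<open>The counterpart of \<open>pcf_halts\<close>: arbitrary further input takes the place of
  arbitrary arguments.\<close>

definition halts :: "nat \<Rightarrow> 'a eam \<Rightarrow> bool" where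
  "halts k M \<longleftrightarrow> (\<exists>j\<le>k. \<exists>T n. (step ^^ j) (M @@ T) (numeral_eam num n))"

lemma halts_mono: "halts j M \<Longrightarrow> j \<le> k \<Longrightarrow> halts k M"
  unfolding halts_def using order_trans by blast

lemma halts_append: "halts k (M @@ as) \<Longrightarrow> halts k M"
  unfolding halts_def by (metis append_tape_simps(3))

lemma strict_at_step:
  assumes "EAM R (Body I) T \<rightarrow>\<^sub>c X" "strict_at i I" "reads R i a"
  shows "(\<exists>M. lookup a \<rightarrow>\<^sub>c M \<and> X = EAM (R[i := Some (addr M)]) (Body I) T) \<or> (\<exists>n. lookup a = numeral_eam num n)"
  using assms(1)
  by (cases rule: step.cases) (use assms(2,3) in \<open>auto simp: strict_at_def dest: reads_unique\<close>)

text \<open>As long as register \<open>i\<close> holds no numeral, the machine can only reduce its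
  content, one step for each of its own. So the evaluation of the content fits into the bound for
  the whole run.\<close>

lemma strict_at_halts:
  assumes "(step ^^ j) (EAM R (Body I) T) (numeral_eam num m)" "strict_at i I" "reads R i a"
  shows "\<exists>j'\<le>j. \<exists>n. (step ^^ j') (lookup a) (numeral_eam num n)"
  using assms(1,3)
proof (induction j arbitrary: R a)
  case 0
  with assms(2) show ?case by (auto simp: numeral_eam_def strict_at_def)
next
  case (Suc j)
  from relpowp_Suc_D2[OF Suc.prems(1)] obtain X where
    X: "EAM R (Body I) T \<rightarrow>\<^sub>c X" "(step ^^ j) X (numeral_eam num m)" by auto
  from strict_at_step[OF X(1) assms(2) Suc.prems(2)] show ?case
  proof
    assume "\<exists>M. lookup a \<rightarrow>\<^sub>c M \<and> X = EAM (R[i := Some (addr M)]) (Body I) T"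
    then obtain M where M: "lookup a \<rightarrow>\<^sub>c M" "X = EAM (R[i := Some (addr M)]) (Body I) T" by blast
    from Suc.IH[of "R[i := Some (addr M)]" "addr M"] X(2) M(2) obtain j' n where
      "j' \<le> j" "(step ^^ j') (lookup (addr M)) (numeral_eam num n)"
      using reads_update[OF Suc.prems(2)] by auto
    moreover have "lookup (addr M) = M"
      using step_machines[OF M(1)] by (simp add: lookup_addr)
    ultimately show ?case using M(1) by (metis Suc_le_mono relpowp_Suc_I2)
  next
    assume "\<exists>n. lookup a = numeral_eam num n"
    then show ?case by (metis le0 relpowp_0_I)
  qed
qed

lemma halts_strict_at:
  "halts k (EAM R (Body I) T) \<Longrightarrow> strict_at i I \<Longrightarrow> reads R i a \<Longrightarrow>
    \<exists>j\<le>k. \<exists>n. (step ^^ j) (lookup a) (numeral_eam num n)"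
  unfolding halts_def using strict_at_halts order_trans by (metis append_tape_simps(1))

lemma strict_at_steps:
  assumes "lookup a \<rightarrow>\<^sub>c* M" "strict_at i I" "reads R i a"
  shows "EAM R (Body I) T \<rightarrow>\<^sub>c* EAM (R[i := Some (addr M)]) (Body I) T"
  using assms(1)
proof induction
  case base
  from assms(3) have "R[i := Some a] = R"
    unfolding reads_def by (metis list_update_id)
  then show ?case by simp
next
  case (step M M')
  from steps_machines[OF step(1)] have M: "lookup (addr M) = M" by (simp add: lookup_addr)
  have "EAM (R[i := Some (addr M)]) (Body I) T \<rightarrow>\<^sub>c EAM (R[i := Some (addr M), i := Some (addr M')]) (Body I) T"
    using assms(2) reads_update[OF assms(3), of "addr M"] step(2) M
    by (auto simp: strict_at_def intro: step.intros simp del: list_update_overwrite)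
  with step.IH show ?case by simp
qed

subsection \<open>The step-indexed relation between machines and programs\<close>

text \<open>
  For \<open>d = True\<close> the machine is approximated by the program, for \<open>d = False\<close> conversely; the
  steps of the approximated side are counted.
\<close>

primrec approx :: "ty \<Rightarrow> bool \<Rightarrow> nat \<Rightarrow> 'a eam \<Rightarrow> pcf \<Rightarrow> bool" where
  "approx IntT d k M P \<longleftrightarrow> (\<forall>n. \<forall>j\<le>k.
    if d then (step ^^ j) M (numeral_eam num n) \<longrightarrow> P \<rightarrow>\<^sub>P* numeral_pcf n
    else (pcf_step ^^ j) P (numeral_pcf n) \<longrightarrow> M \<rightarrow>\<^sub>c* numeral_eam num n)"
| "approx (\<alpha> \<rightarrow>\<^sub>t \<beta>) d k M P \<longleftrightarrow> (\<forall>j\<le>k. \<forall>a\<in>typed_addrs \<alpha>. \<forall>Q. pcf_program Q \<alpha> \<longrightarrow>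
    approx \<alpha> d j (lookup a) Q \<longrightarrow> approx \<beta> d j (M @@ [a]) (App P Q))"

text \<open>Holds without induction, as the clause for function types quantifies over all smaller
  indices.\<close>

lemma approx_mono: "approx \<alpha> d k M P \<Longrightarrow> j \<le> k \<Longrightarrow> approx \<alpha> d j M P"
  by (cases \<alpha>) (auto split: if_splits)

text \<open>Expansion costs no index. On the counted side the run to a numeral passes through the
  reduct by determinism and has no more steps left there; on the other side steps are free.\<close>

lemma approx_expand:
  "M \<rightarrow>\<^sub>c* M' \<Longrightarrow> P \<rightarrow>\<^sub>P* P' \<Longrightarrow> approx \<alpha> d k M' P' \<Longrightarrow> approx \<alpha> d k M P"
proof (induction \<alpha> arbitrary: k M M' P P')
  case IntT
  obtain i where i: "(step ^^ i) M M'" using IntT(1) by (metis rtranclp_imp_relpowp)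
  obtain i' where i': "(pcf_step ^^ i') P P'" using IntT(2) by (metis rtranclp_imp_relpowp)
  show ?case
  proof (cases d)
    case True
    have "P \<rightarrow>\<^sub>P* numeral_pcf n" if "j \<le> k" "(step ^^ j) M (numeral_eam num n)" for j n
    proof -
      from step_prefix[OF i that(2)] that(1) have "j - i \<le> k" "(step ^^ (j - i)) M' (numeral_eam num n)"
        by auto
      with IntT(3) True have "P' \<rightarrow>\<^sub>P* numeral_pcf n" by simp
      with IntT(2) show ?thesis by simp
    qed
    with True show ?thesis by simp
  next
    case False
    have "M \<rightarrow>\<^sub>c* numeral_eam num n" if "j \<le> k" "(pcf_step ^^ j) P (numeral_pcf n)" for j n
    proof -
      from pcf_prefix[OF i' that(2)] that(1) have "j - i' \<le> k" "(pcf_step ^^ (j - i')) P' (numeral_pcf n)"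
        by auto
      with IntT(3) False have "M' \<rightarrow>\<^sub>c* numeral_eam num n" by simp
      with IntT(1) show ?thesis by simp
    qed
    with False show ?thesis by simp
  qed
next
  case (Arrow \<alpha> \<beta>)
  have "App P Q \<rightarrow>\<^sub>P* App P' Q" for Q
    using Arrow.prems(2) by (rule steps_map[of pcf_step pcf_step "\<lambda>P. App P Q", rotated]) (rule ctx_app)
  moreover have "M @@ [a] \<rightarrow>\<^sub>c* M' @@ [a]" for a
    using Arrow.prems(1) by (rule steps_append)
  ultimately show ?case
    using Arrow.prems(3) Arrow.IH(2) by (simp, blast)
qed

text \<open>If both sides make at least one step, then whichever side is counted has spent one, and
  the reducts need to be related at smaller indices only. This is where recursion becomes an
  induction on the index.\<close>

lemma approx_expand_strict:
  "M \<rightarrow>\<^sub>c M'' \<Longrightarrow> M'' \<rightarrow>\<^sub>c* M' \<Longrightarrow> P \<rightarrow>\<^sub>P P' \<Longrightarrow> (\<And>j. j < k \<Longrightarrow> approx \<alpha> d j M' P') \<Longrightarrow> approx \<alpha> d k M P"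
proof (induction \<alpha> arbitrary: k M M'' M' P P')
  case IntT
  show ?case
  proof (cases d)
    case True
    have "P \<rightarrow>\<^sub>P* numeral_pcf n" if "j \<le> k" "(step ^^ j) M (numeral_eam num n)" for j n
    proof -
      from IntT(1) that(2) obtain j' where j': "j = Suc j'"
        using numeral_eam_no_step by (cases j) auto
      have "(step ^^ 1) M M''" using IntT(1) by (simp only: relpowp_1)
      from step_prefix[OF this that(2)] j' have "(step ^^ j') M'' (numeral_eam num n)" by simp
      moreover have "approx IntT d j' M'' P'"
        using approx_expand[OF IntT(2) rtranclp.rtrancl_refl IntT(4)[of j']] j' that(1) by simp
      ultimately have "P' \<rightarrow>\<^sub>P* numeral_pcf n" using True by (simp, metis le_refl)
      with IntT(3) show ?thesis by (rule converse_rtranclp_into_rtranclp)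
    qed
    with True show ?thesis by simp
  next
    case False
    have "M \<rightarrow>\<^sub>c* numeral_eam num n" if "j \<le> k" "(pcf_step ^^ j) P (numeral_pcf n)" for j n
    proof -
      from IntT(3) that(2) obtain j' where j': "j = Suc j'"
        using numeral_pcf_no_step by (cases j) auto
      have "(pcf_step ^^ 1) P P'" using IntT(3) by (simp only: relpowp_1)
      from pcf_prefix[OF this that(2)] j' have "(pcf_step ^^ j') P' (numeral_pcf n)" by simp
      with IntT(4)[of j'] j' that(1) False have "M' \<rightarrow>\<^sub>c* numeral_eam num n" by (simp, metis le_refl)
      with IntT(1,2) show ?thesis by auto
    qed
    with False show ?thesis by simp
  qed
next
  case (Arrow \<alpha> \<beta>)
  show ?case
  proof (simp, intro allI impI ballI)
    fix j a Q assume j: "j \<le> k" and a: "a \<in> typed_addrs \<alpha>" "pcf_program Q \<alpha>" "approx \<alpha> d j (lookup a) Q"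
    show "approx \<beta> d j (M @@ [a]) (App P Q)"
    proof (rule Arrow.IH(2)[OF step_append[OF Arrow.prems(1)] steps_append[OF Arrow.prems(2)] ctx_app[OF Arrow.prems(3)]])
      fix i assume "i < j"
      with j Arrow.prems(4)[of i] a approx_mono[OF a(3), of i] show "approx \<beta> d i (M' @@ [a]) (App P' Q)"
        by auto
    qed
  qed
qed

text \<open>At \<open>IntT\<close> the relation is vacuous unless the counted side reaches a numeral
  within \<open>k\<close> steps. At function types the same is said of the result of an application,
  and if that result halts for some arguments then so does the function. Hence halting may be
  assumed at every type.\<close>

lemma approx_if_halts:
  "((if d then halts k M else pcf_halts k P) \<Longrightarrow> approx \<alpha> d k M P) \<Longrightarrow> approx \<alpha> d k M P"
proof (induction \<alpha> arbitrary: k M P)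
  case IntT
  show ?case
  proof (cases "if d then halts k M else pcf_halts k P")
    case True
    with IntT show ?thesis by blast
  next
    case False
    have "halts k M" if "j \<le> k" "(step ^^ j) M (numeral_eam num n)" for j n
      unfolding halts_def using that by (metis append_tape_simps(2))
    moreover have "pcf_halts k P" if "j \<le> k" "(pcf_step ^^ j) P (numeral_pcf n)" for j n
      unfolding pcf_halts_def using that by (metis foldl_Nil)
    ultimately show ?thesis using False by (auto split: if_splits)
  qed
next
  case (Arrow \<alpha> \<beta>)
  show ?case
  proof (simp, intro allI impI ballI)
    fix j a Q assume j: "j \<le> k" and a: "a \<in> typed_addrs \<alpha>" "pcf_program Q \<alpha>" "approx \<alpha> d j (lookup a) Q"
    show "approx \<beta> d j (M @@ [a]) (App P Q)"
    proof (rule Arrow.IH(2))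
      assume "if d then halts j (M @@ [a]) else pcf_halts j (App P Q)"
      then have "if d then halts k M else pcf_halts k P"
        using halts_append pcf_halts_App halts_mono pcf_halts_mono j by (metis (full_types))
      from Arrow.prems[OF this] j a show "approx \<beta> d j (M @@ [a]) (App P Q)" by simp
    qed
  qed
qed

lemma approx_numeral:
  assumes "L \<rightarrow>\<^sub>P* numeral_pcf n"
  shows "approx IntT d k (numeral_eam num n) L"
proof (cases d)
  case True
  have "m = n" if "(step ^^ j) (numeral_eam num n) (numeral_eam num m)" for j m
    using that numeral_eam_no_step by (metis numeral_eam_inject relpowp_E2)
  with True assms show ?thesis by auto
next
  case False
  have "m = n" if "(pcf_step ^^ j) L (numeral_pcf m)" for j m
    using relpowp_imp_rtranclp[OF that] assms by (rule pcf_steps_numeral_unique)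
  with False show ?thesis by auto
qed

text \<open>
  Both sides evaluate the content \<open>a\<close> of register \<open>i\<close> and the term \<open>L\<close> first, so that these may be
  assumed to have the same value.
\<close>

lemma approx_strict:
  assumes I: "strict_at i I" and a: "reads R i a" "approx IntT d k (lookup a) L"
    and S: "S = Ifz L A B \<or> S = Pred L \<or> S = Succ L"
    and *: "\<And>n. L \<rightarrow>\<^sub>P* numeral_pcf n \<Longrightarrow> approx \<alpha> d k (EAM (R[i := Some (num n)]) (Body I) T) S"
  shows "approx \<alpha> d k (EAM R (Body I) T) S"
proof (rule approx_if_halts)
  assume h: "if d then halts k (EAM R (Body I) T) else pcf_halts k S"
  \<comment> \<open>The counted side halts, so its own argument has a value within \<open>k\<close>
    steps; the hypothesis on the arguments carries this value to the other side.\<close>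
  have "\<exists>n. lookup a \<rightarrow>\<^sub>c* numeral_eam num n \<and> L \<rightarrow>\<^sub>P* numeral_pcf n"
  proof (cases d)
    case True
    with h halts_strict_at[OF _ I a(1)] obtain j n where
      "j \<le> k" "(step ^^ j) (lookup a) (numeral_eam num n)" by metis
    with a(2) True show ?thesis
      by (auto dest: relpowp_imp_rtranclp)
  next
    case False
    with h S pcf_halts_Ifz pcf_halts_Pred pcf_halts_Succ obtain j n where
      "j \<le> k" "(pcf_step ^^ j) L (numeral_pcf n)" by metis
    with a(2) False show ?thesis
      by (auto dest: relpowp_imp_rtranclp)
  qed
  then obtain n where n: "lookup a \<rightarrow>\<^sub>c* numeral_eam num n" "L \<rightarrow>\<^sub>P* numeral_pcf n" by blast
  from strict_at_steps[OF n(1) I a(1), of T]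
  have "EAM R (Body I) T \<rightarrow>\<^sub>c* EAM (R[i := Some (num n)]) (Body I) T"
    by (simp add: addr_numeral)
  then show "approx \<alpha> d k (EAM R (Body I) T) S"
    by (rule approx_expand[OF _ rtranclp.rtrancl_refl *[OF n(2)]])
qed

lemmas approx_expand_left = approx_expand[OF _ rtranclp.rtrancl_refl]
lemmas approx_expand_right = approx_expand[OF rtranclp.rtrancl_refl]

section \<open>Lists of related arguments\<close>

inductive related :: "bool \<Rightarrow> nat \<Rightarrow> ty list \<Rightarrow> 'a list \<Rightarrow> pcf list \<Rightarrow> bool" for d k where
  related_Nil: "related d k [] [] []"
| related_Cons: "a \<in> typed_addrs \<tau> \<Longrightarrow> pcf_program Q \<tau> \<Longrightarrow> approx \<tau> d k (lookup a) Q \<Longrightarrow>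
    related d k \<tau>s as Qs \<Longrightarrow> related d k (\<tau> # \<tau>s) (a # as) (Q # Qs)"

lemma related_programs: "related d k \<tau>s as Qs \<Longrightarrow> programs \<tau>s Qs"
  by (induction rule: related.induct) auto

lemma related_length: "related d k \<tau>s as Qs \<Longrightarrow> length as = length \<tau>s"
  by (induction rule: related.induct) auto

lemma related_mono: "related d k \<tau>s as Qs \<Longrightarrow> j \<le> k \<Longrightarrow> related d j \<tau>s as Qs"
  by (induction rule: related.induct) (auto intro: related.intros approx_mono)

lemma related_snoc:
  "related d k \<tau>s as Qs \<Longrightarrow> a \<in> typed_addrs \<tau> \<Longrightarrow> pcf_program Q \<tau> \<Longrightarrow> approx \<tau> d k (lookup a) Q \<Longrightarrow>
    related d k (\<tau>s @ [\<tau>]) (as @ [a]) (Qs @ [Q])"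
  by (induction rule: related.induct) (auto intro: related.intros)

lemma related_nth:
  "related d k \<tau>s as Qs \<Longrightarrow> i < length \<tau>s \<Longrightarrow> approx (\<tau>s ! i) d k (lookup (as ! i)) (Qs ! i)"
proof (induction arbitrary: i rule: related.induct)
  case (related_Cons a \<tau> Q \<tau>s as Qs)
  then show ?case by (cases i) auto
qed simp

lemma approx_apps:
  "related d k \<tau>s as Qs \<Longrightarrow> approx (foldr (\<rightarrow>\<^sub>t) \<tau>s \<alpha>) d k M P \<Longrightarrow> approx \<alpha> d k (M @@ as) (foldl App P Qs)"
proof (induction arbitrary: M P rule: related.induct)
  case (related_Cons a \<tau> Q \<tau>s as Qs)
  then have "approx (foldr (\<rightarrow>\<^sub>t) \<tau>s \<alpha>) d k (M @@ [a]) (App P Q)" by auto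
  from related_Cons.IH[OF this] show ?case by simp
qed simp

subsection \<open>Machines have types stable under application\<close>

lemma tape_typed_snoc: "tape_typed T \<beta>s \<Longrightarrow> eam_typed (lookup a) \<alpha> \<Longrightarrow> tape_typed (T @ [a]) (\<beta>s @ [\<alpha>])"
proof (induction T arbitrary: \<beta>s)
  case Nil
  then have "\<beta>s = []" by (auto elim: tape_typed.cases)
  with Nil show ?case by (auto intro: T_tape_Nil T_tape_Cons)
next
  case (Cons b T)
  from Cons.prems(1) obtain \<beta> \<beta>s' where "\<beta>s = \<beta> # \<beta>s'" "eam_typed (lookup b) \<beta>" "tape_typed T \<beta>s'"
    by (auto elim: tape_typed.cases)
  with Cons.IH Cons.prems(2) show ?case by (auto intro: T_tape_Cons)
qed

text \<open>The operations do not touch the tape. Appended input only reaches the final call, whose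
  list of argument types grows by one.\<close>

lemma body_typed_snoc:
  "body_typed r \<Delta> A T (\<alpha> \<rightarrow>\<^sub>t \<beta>) \<Longrightarrow> eam_typed (lookup a) \<alpha> \<Longrightarrow> body_typed r \<Delta> A (T @ [a]) \<beta>"
proof (induction A arbitrary: \<Delta>)
  case Eps
  then show ?case by (auto elim: body_typed.cases)
next
  case (Call i)
  from Call.prems(1) obtain \<beta>s where "\<Delta> i = Some (foldr (\<rightarrow>\<^sub>t) \<beta>s (\<alpha> \<rightarrow>\<^sub>t \<beta>))" "tape_typed T \<beta>s"
    by (auto elim: body_typed.cases)
  with T_call[of \<Delta> i "\<beta>s @ [\<alpha>]" \<beta> "T @ [a]"] tape_typed_snoc Call.prems(2) show ?case by auto
next
  case (AppI k i j A)
  from AppI.prems(1) show ?case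
    by (cases rule: body_typed.cases) (use AppI.IH AppI.prems(2) in \<open>auto intro: T_app\<close>)
next
  case (TestI l i j k A)
  from TestI.prems(1) show ?case
    by (cases rule: body_typed.cases) (use TestI.IH TestI.prems(2) in \<open>auto intro: T_test\<close>)
next
  case (PredI k i A)
  from PredI.prems(1) show ?case
    by (cases rule: body_typed.cases) (use PredI.IH PredI.prems(2) in \<open>auto intro: T_pred\<close>)
next
  case (SuccI k i A)
  from SuccI.prems(1) show ?case
    by (cases rule: body_typed.cases) (use SuccI.IH SuccI.prems(2) in \<open>auto intro: T_succ\<close>)
qed

text \<open>Either the tape runs out at a \<open>Load\<close>, whose arrow type came from
  \<open>T_load_empty\<close> and which now consumes the new address by \<open>T_load\<close>, or
  the address travels on to the final call.\<close>

lemma program_typed_snoc: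
  "program_typed r \<Delta> P T (\<alpha> \<rightarrow>\<^sub>t \<beta>) \<Longrightarrow> eam_typed (lookup a) \<alpha> \<Longrightarrow> program_typed r \<Delta> P (T @ [a]) \<beta>"
proof (induction P arbitrary: \<Delta> T)
  case (Load i P)
  from Load.prems(1) show ?case
  proof (cases rule: program_typed.cases)
    case (T_load_empty)
    with Load.prems(2) show ?thesis by (auto intro: T_load)
  next
    case (T_load b \<gamma> T')
    with Load.IH[OF T_load(3) Load.prems(2)] show ?thesis
      by (auto intro: address_map.T_load[OF address_map_axioms])
  qed
next
  case (Body A)
  then show ?case by (auto elim!: program_typed.cases intro: T_body body_typed_snoc)
qed

lemma Y_eam_typed_regs: "regs_typed [None, Some y] [1 \<mapsto> (\<alpha> \<rightarrow>\<^sub>t \<alpha>) \<rightarrow>\<^sub>t \<alpha>]"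
  using T_regs_Some[OF T_regs_None[OF T_regs_Nil], of y "(\<alpha> \<rightarrow>\<^sub>t \<alpha>) \<rightarrow>\<^sub>t \<alpha>"] T_fix by simp

text \<open>\<open>T_fix\<close> speaks of the empty tape only. With an argument the machine is
  typed by the ordinary rules, and \<open>T_fix\<close> is used for the address in its own
  register.\<close>

lemma Y_eam_app_typed: "eam_typed (lookup a) (\<alpha> \<rightarrow>\<^sub>t \<alpha>) \<Longrightarrow> eam_typed (Y_eam y @@ [a]) \<alpha>"
proof -
  assume a: "eam_typed (lookup a) (\<alpha> \<rightarrow>\<^sub>t \<alpha>)"
  have "program_typed 2 [1 \<mapsto> (\<alpha> \<rightarrow>\<^sub>t \<alpha>) \<rightarrow>\<^sub>t \<alpha>] (Load 0 (Body (AppI 1 1 0 (AppI 1 0 1 (Call 1))))) [a] \<alpha>"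
    by (intro T_load[OF a] T_body T_app[where \<beta> = "\<alpha> \<rightarrow>\<^sub>t \<alpha>" and \<gamma> = \<alpha>] T_app[where \<beta> = \<alpha> and \<gamma> = \<alpha>]
        T_call[where \<beta>s = "[]"] T_tape_Nil) (auto simp: set_ty_def)
  with T_eam[OF Y_eam_typed_regs, where T = "[a]"] show ?thesis
    by (simp add: Y_eam_def numeral_2_eq_2)
qed

lemma eam_typed_snoc: "eam_typed M (\<alpha> \<rightarrow>\<^sub>t \<beta>) \<Longrightarrow> eam_typed (lookup a) \<alpha> \<Longrightarrow> eam_typed (M @@ [a]) \<beta>"
  by (erule eam_typed.cases) (auto intro: T_eam program_typed_snoc Y_eam_app_typed)

lemma typed_addrs_dot:
  "a \<in> typed_addrs (\<alpha> \<rightarrow>\<^sub>t \<beta>) \<Longrightarrow> b \<in> typed_addrs \<alpha> \<Longrightarrow> dot a b \<in> typed_addrs \<beta>"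
  by (simp add: typed_addrs_def eam_typed_snoc)

lemma eam_typed_apps:
  "related d k \<tau>s as Qs \<Longrightarrow> eam_typed M (foldr (\<rightarrow>\<^sub>t) \<tau>s \<alpha>) \<Longrightarrow> eam_typed (M @@ as) \<alpha>"
proof (induction arbitrary: M rule: related.induct)
  case (related_Cons a \<tau> Q \<tau>s as Qs)
  then have "eam_typed (M @@ [a]) (foldr (\<rightarrow>\<^sub>t) \<tau>s \<alpha>)" by (auto simp: typed_addrs_def intro: eam_typed_snoc)
  from related_Cons.IH[OF this] show ?case by simp
qed simp

lemma dom_set_ty: "dom (set_ty r \<Delta> i \<beta>) = initialise r (dom \<Delta>) i"
  by (auto simp: set_ty_def initialise_def)

lemma dom_set_ty_bounded: "dom \<Delta> \<subseteq> {..<r} \<Longrightarrow> dom (set_ty r \<Delta> i \<beta>) \<subseteq> {..<r}"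
  by (auto simp: set_ty_def)

lemma initialised_snoc:
  "initialised (R @ [x]) = (if x = None then initialised R else insert (length R) (initialised R))"
  by (auto simp: initialised_def nth_append less_Suc_eq)

text \<open>Typing is defined on raw tuples. That typed ones are valid is what allows
  \<open>lookup_addr\<close> to be applied to them, in particular to the translations of
  subterms.\<close>

lemma typed_valid:
  "eam_typed M \<alpha> \<Longrightarrow> M \<in> machines"
  "regs_typed R \<Delta> \<Longrightarrow> dom \<Delta> = initialised R"
  "program_typed r \<Delta> P T \<alpha> \<Longrightarrow> valid_program r (dom \<Delta>) P"
  "body_typed r \<Delta> A T \<alpha> \<Longrightarrow> valid_body r (dom \<Delta>) A"
  "tape_typed T \<beta>s \<Longrightarrow> True"
proof (induction rule: eam_typed_regs_typed_program_typed_body_typed_tape_typed.inducts)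
  case (T_regs_None R \<Delta>)
  then show ?case by (simp add: initialised_snoc)
next
  case (T_regs_Some R \<Delta> a \<beta>)
  have "dom (\<Delta>(length R \<mapsto> \<beta>)) = insert (length R) (dom \<Delta>)" by simp
  with T_regs_Some show ?case by (simp only: initialised_snoc) simp
qed (auto simp: numeral_eam_machines Y_eam_machines machines_EAM dom_set_ty initialised_def domI)

lemma regs_typed_dom: "regs_typed R \<Delta> \<Longrightarrow> dom \<Delta> \<subseteq> {..<length R}"
  using typed_valid(2) by (auto simp: initialised_def)

subsection \<open>Every typed machine is definable\<close>

text \<open>The default \<open>IntT\<close> lets a defining term take one argument per register,
  initialised or not, so that positions of registers and arguments always agree.\<close>

definition ty_of :: "(nat \<rightharpoonup> ty) \<Rightarrow> nat \<Rightarrow> ty" where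
  "ty_of \<Delta> i = (case \<Delta> i of None \<Rightarrow> IntT | Some \<beta> \<Rightarrow> \<beta>)"

definition tys :: "nat \<Rightarrow> (nat \<rightharpoonup> ty) \<Rightarrow> ty list" where
  "tys r \<Delta> = map (ty_of \<Delta>) [0..<r]"

lemma length_tys [simp]: "length (tys r \<Delta>) = r"
  by (simp add: tys_def)

lemma nth_tys: "\<Delta> i = Some \<beta> \<Longrightarrow> i < r \<Longrightarrow> tys r \<Delta> ! i = \<beta>"
  by (simp add: tys_def ty_of_def)

lemma tys_set_ty: "tys r (set_ty r \<Delta> i \<beta>) = (tys r \<Delta>)[i := \<beta>]"
  by (rule nth_equalityI) (auto simp: tys_def set_ty_def ty_of_def nth_list_update)

text \<open>Where \<Delta> is undefined the entry of \<open>Qs\<close> is an arbitrary program of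
  the default type, unconnected with the register.\<close>

definition env :: "bool \<Rightarrow> nat \<Rightarrow> (nat \<rightharpoonup> ty) \<Rightarrow> 'a option list \<Rightarrow> pcf list \<Rightarrow> bool" where
  "env d k \<Delta> R Qs \<longleftrightarrow> programs (tys (length R) \<Delta>) Qs \<and>
    (\<forall>i<length R. \<forall>\<beta>. \<Delta> i = Some \<beta> \<longrightarrow>
      (\<exists>a. reads R i a \<and> a \<in> typed_addrs \<beta> \<and> approx \<beta> d k (lookup a) (Qs ! i)))"

lemma env_length: "env d k \<Delta> R Qs \<Longrightarrow> length Qs = length R"
  by (auto simp: env_def dest: programs_length)

lemma env_mono: "env d k \<Delta> R Qs \<Longrightarrow> j \<le> k \<Longrightarrow> env d j \<Delta> R Qs"
  unfolding env_def using approx_mono by blast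

lemma env_program: "env d k \<Delta> R Qs \<Longrightarrow> \<Delta> i = Some \<beta> \<Longrightarrow> i < length R \<Longrightarrow> pcf_program (Qs ! i) \<beta>"
  unfolding env_def programs_def using nth_tys by (metis length_tys list_all2_nthD)

lemma env_reads:
  assumes "env d k \<Delta> R Qs" "\<Delta> i = Some \<beta>" "i < length R"
  obtains a where "reads R i a" "a \<in> typed_addrs \<beta>" "approx \<beta> d k (lookup a) (Qs ! i)"
  using assms unfolding env_def by blast

lemma programs_snoc: "programs \<tau>s Qs \<Longrightarrow> pcf_program Q \<tau> \<Longrightarrow> programs (\<tau>s @ [\<tau>]) (Qs @ [Q])"
  by (simp add: programs_def list_all2_appendI)

lemma programs_update: "programs \<tau>s Qs \<Longrightarrow> pcf_program Q \<tau> \<Longrightarrow> programs (\<tau>s[i := \<tau>]) (Qs[i := Q])"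
  unfolding programs_def by (rule list_all2_update_cong)

text \<open>A write to a register that does not exist is harmless: both list updates and
  \<open>set_ty\<close> discard it alike.\<close>

lemma env_update:
  assumes "env d k \<Delta> R Qs" "a \<in> typed_addrs \<beta>" "pcf_program Q \<beta>" "approx \<beta> d k (lookup a) Q"
  shows "env d k (set_ty (length R) \<Delta> i \<beta>) (R[i := Some a]) (Qs[i := Q])"
proof -
  have "programs (tys (length R) (set_ty (length R) \<Delta> i \<beta>)) (Qs[i := Q])"
    unfolding tys_set_ty using assms(1,3) by (intro programs_update) (auto simp: env_def)
  moreover have "\<exists>b. reads (R[i := Some a]) j b \<and> b \<in> typed_addrs \<gamma> \<and> approx \<gamma> d k (lookup b) (Qs[i := Q] ! j)"
    if "j < length R" "set_ty (length R) \<Delta> i \<beta> j = Some \<gamma>" for j \<gamma>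
  proof (cases "i = j")
    case True
    with that assms(2,4) env_length[OF assms(1)] show ?thesis by (auto simp: reads_def set_ty_def)
  next
    case False
    with that have "\<Delta> j = Some \<gamma>" by (auto simp: set_ty_def split: if_splits)
    from env_reads[OF assms(1) this that(1)] show ?thesis
      using False by (auto simp: reads_def)
  qed
  ultimately show ?thesis by (simp add: env_def)
qed

text \<open>A strict instruction overwrites its register by a value while the term keeps the
  unevaluated \<open>Qs ! i\<close>. The two remain related because that term has the same
  value.\<close>

lemma env_update_num:
  assumes "env d k \<Delta> R Qs" "\<Delta> i = Some IntT" "i < length R" "Qs ! i \<rightarrow>\<^sub>P* numeral_pcf n"
  shows "env d k \<Delta> (R[i := Some (num n)]) Qs"
proof -
  have "set_ty (length R) \<Delta> i IntT = \<Delta>"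
    using assms(2,3) by (auto simp: set_ty_def)
  moreover have "num n \<in> typed_addrs IntT" by (simp add: typed_addrs_def T_num)
  ultimately show ?thesis
    using env_update[OF assms(1), of "num n" IntT "Qs ! i" i] approx_numeral[OF assms(4)]
      env_program[OF assms(1-3)] by simp
qed

text \<open>The term \<open>N\<close> is fixed before the contents of the registers, the direction
  and the index. This uniformity is what the induction on programs needs, since each instruction
  changes the registers.\<close>

definition denotes :: "pcf \<Rightarrow> nat \<Rightarrow> (nat \<rightharpoonup> ty) \<Rightarrow> program \<Rightarrow> 'a list \<Rightarrow> ty \<Rightarrow> bool" where
  "denotes N r \<Delta> P T \<alpha> \<longleftrightarrow> pcf_program N (foldr (\<rightarrow>\<^sub>t) (tys r \<Delta>) \<alpha>) \<and>
    (\<forall>d k R Qs. length R = r \<longrightarrow> env d k \<Delta> R Qs \<longrightarrow> approx \<alpha> d k (EAM R P T) (foldl App N Qs))"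

lemma denotesI:
  assumes "pcf_typed (rev (tys r \<Delta>)) B \<alpha>"
    and "\<And>d k R Qs. length R = r \<Longrightarrow> env d k \<Delta> R Qs \<Longrightarrow> approx \<alpha> d k (EAM R P T) (msubst 0 Qs B)"
  shows "\<exists>N. denotes N r \<Delta> P T \<alpha>"
  unfolding denotes_def
proof (intro exI conjI allI impI)
  show "pcf_program ((Lam ^^ length (tys r \<Delta>)) B) (foldr (\<rightarrow>\<^sub>t) (tys r \<Delta>) \<alpha>)"
    by (rule lams_typed) (use assms(1) in simp)
  fix d k R Qs assume R: "length R = r" and e: "env d k \<Delta> R Qs"
  then have "programs (tys r \<Delta>) Qs" by (auto simp: env_def)
  from approx_expand_right[OF lams_steps[OF this] assms(2)[OF R e]]
  show "approx \<alpha> d k (EAM R P T) (foldl App ((Lam ^^ length (tys r \<Delta>)) B) Qs)" .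
qed

text \<open>Unlike de Bruijn indices, \<open>k\<close> counts variables from the outermost one, as registers do.\<close>

definition call_with :: "nat \<Rightarrow> nat \<Rightarrow> pcf \<Rightarrow> nat \<Rightarrow> pcf \<Rightarrow> pcf" where
  "call_with m r N k t = foldl App N ((map (\<lambda>i. Var (m - 1 - i)) [0..<r])[k := t])"

text \<open>The scope may have more variables than there are registers: loading from an empty tape
  abstracts over the missing input, which is then an additional innermost variable.\<close>

lemma call_with_typed:
  assumes "pcf_program N (foldr (\<rightarrow>\<^sub>t) ((take r \<tau>s)[k := \<beta>]) \<alpha>)" "r \<le> length \<tau>s" "pcf_typed (rev \<tau>s) t \<beta>"
  shows "pcf_typed (rev \<tau>s) (call_with (length \<tau>s) r N k t) \<alpha>"
  unfolding call_with_def
proof (rule foldl_App_typed)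
  show "pcf_typed (rev \<tau>s) N (foldr (\<rightarrow>\<^sub>t) ((take r \<tau>s)[k := \<beta>]) \<alpha>)"
    using assms(1) by (rule program_typed_any)
  have "list_all2 (\<lambda>\<tau> Q. pcf_typed (rev \<tau>s) Q \<tau>) (take r \<tau>s) (map (\<lambda>i. Var (length \<tau>s - 1 - i)) [0..<r])"
    using assms(2) Var_typed by (auto simp: list_all2_conv_all_nth)
  then show "list_all2 (\<lambda>\<tau> Q. pcf_typed (rev \<tau>s) Q \<tau>) ((take r \<tau>s)[k := \<beta>])
      ((map (\<lambda>i. Var (length \<tau>s - 1 - i)) [0..<r])[k := t])"
    using assms(3) by (rule list_all2_update_cong)
qed

lemma call_with_msubst:
  assumes "programs \<tau>s Qs" "r \<le> length \<tau>s" "pcf_program N \<gamma>"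
  shows "msubst 0 Qs (call_with (length \<tau>s) r N k t) = foldl App N ((take r Qs)[k := msubst 0 Qs t])"
proof -
  have "map (\<lambda>i. msubst 0 Qs (Var (length \<tau>s - 1 - i))) [0..<r] = take r Qs"
    using msubst_Var[OF assms(1)] programs_length[OF assms(1)] assms(2)
    by (auto intro!: nth_equalityI)
  then show ?thesis
    using assms(3) by (simp add: call_with_def map_update comp_def)
qed

lemma denotes_call_with_typed:
  assumes "denotes N r (set_ty r \<Delta> i \<beta>) P T \<alpha>" "pcf_typed (rev (tys r \<Delta>)) t \<beta>"
  shows "pcf_typed (rev (tys r \<Delta>)) (call_with r r N i t) \<alpha>"
  using call_with_typed[of N r "tys r \<Delta>" i \<beta> \<alpha> t] assms by (simp add: denotes_def tys_set_ty)

text \<open>The step shared by all instructions that write: an assignment to a register becomes a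
  call of the remaining program's term with one argument changed.\<close>

lemma denotes_call_with:
  assumes N: "denotes N (length R) (set_ty (length R) \<Delta> i \<beta>) P T \<alpha>" and e: "env d k \<Delta> R Qs"
    and a: "a \<in> typed_addrs \<beta>" "approx \<beta> d k (lookup a) (msubst 0 Qs t)"
    and t: "pcf_typed (rev (tys (length R) \<Delta>)) t \<beta>"
  shows "approx \<alpha> d k (EAM (R[i := Some a]) P T) (msubst 0 Qs (call_with (length R) (length R) N i t))"
proof -
  have Qs: "programs (tys (length R) \<Delta>) Qs" using e by (simp add: env_def)
  have "env d k (set_ty (length R) \<Delta> i \<beta>) (R[i := Some a]) (Qs[i := msubst 0 Qs t])"
    using env_update[OF e a(1) msubst_typed[OF Qs t] a(2)] .
  moreover have "msubst 0 Qs (call_with (length R) (length R) N i t) = foldl App N (Qs[i := msubst 0 Qs t])"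
    using call_with_msubst[OF Qs, of "length R" N] N env_length[OF e] by (auto simp: denotes_def)
  ultimately show ?thesis
    using N by (auto simp: denotes_def)
qed

definition reg :: "nat \<Rightarrow> nat \<Rightarrow> pcf" where
  "reg r i = Var (r - 1 - i)"

lemma reg_typed: "\<Delta> i = Some \<beta> \<Longrightarrow> i < r \<Longrightarrow> pcf_typed (rev (tys r \<Delta>)) (reg r i) \<beta>"
  using Var_typed[of i "tys r \<Delta>"] by (simp add: nth_tys reg_def)

lemma reg_msubst: "env d k \<Delta> R Qs \<Longrightarrow> i < length R \<Longrightarrow> msubst 0 Qs (reg (length R) i) = Qs ! i"
  unfolding env_def reg_def using msubst_Var programs_length by (metis length_tys)

text \<open>The loading step is kept apart so that \<open>approx_expand_strict\<close> sees a step
  that is certainly made.\<close>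

lemma Y_eam_steps:
  "Y_eam y @@ [a] \<rightarrow>\<^sub>c EAM [Some a, Some y] (Body (AppI 1 1 0 (AppI 1 0 1 (Call 1)))) []" (is ?A)
  "EAM [Some a, Some y] (Body (AppI 1 1 0 (AppI 1 0 1 (Call 1)))) [] \<rightarrow>\<^sub>c* lookup a @@ [dot y a]" (is ?B)
proof -
  show ?A using step.Load[of "[None, Some y]" 0 _ a "[]"] by (simp add: Y_eam_def)
  have "EAM [Some a, Some y] (Body (AppI 1 1 0 (AppI 1 0 1 (Call 1)))) [] \<rightarrow>\<^sub>c
    EAM [Some a, Some (dot y a)] (Body (AppI 1 0 1 (Call 1))) []"
    using step.App[of "[Some a, Some y]" 1 y 0 a 1] by (simp add: reads_def)
  moreover have "EAM [Some a, Some (dot y a)] (Body (AppI 1 0 1 (Call 1))) [] \<rightarrow>\<^sub>c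
    EAM [Some a, Some (dot a (dot y a))] (Body (Call 1)) []"
    using step.App[of "[Some a, Some (dot y a)]" 0 a 1 "dot y a" 1] by (simp add: reads_def)
  moreover have "EAM [Some a, Some (dot a (dot y a))] (Body (Call 1)) [] \<rightarrow>\<^sub>c lookup a @@ [dot y a]"
    using step.Call[of "[Some a, Some (dot a (dot y a))]" 1 "dot a (dot y a)" "[]"] by (simp add: reads_def)
  ultimately show ?B by (meson converse_rtranclp_into_rtranclp rtranclp.rtrancl_refl)
qed

text \<open>One unfolding takes at least one step on each side, so the recursive occurrences
  \<open>dot y a\<close> and \<open>Fix Q\<close> only have to be related at smaller indices, which
  is the induction hypothesis.\<close>

lemma approx_fix:
  assumes a: "a \<in> typed_addrs (\<alpha> \<rightarrow>\<^sub>t \<alpha>)" and Q: "pcf_program Q (\<alpha> \<rightarrow>\<^sub>t \<alpha>)"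
  shows "approx (\<alpha> \<rightarrow>\<^sub>t \<alpha>) d k (lookup a) Q \<Longrightarrow> approx \<alpha> d k (Y_eam y @@ [a]) (Fix Q)"
proof (induction k rule: less_induct)
  case (less k)
  show ?case
  proof (rule approx_expand_strict[OF Y_eam_steps unfold_fix])
    fix j assume j: "j < k"
    have "approx (\<alpha> \<rightarrow>\<^sub>t \<alpha>) d j (lookup a) Q"
      using approx_mono[OF less.prems, of j] j less_imp_le by blast
    moreover have "dot y a \<in> typed_addrs \<alpha>"
      using a by (simp add: typed_addrs_def Y_eam_app_typed)
    moreover have "pcf_program (Fix Q) \<alpha>" using Q by (rule pcf_typed.intros)
    ultimately show "approx \<alpha> d j (lookup a @@ [dot y a]) (App Q (Fix Q))"
      using less.IH[OF j] by simp
  qed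
qed

text \<open>Registers are read as arguments: a \<open>Load\<close> on an empty tape becomes an
  abstraction, every write becomes a call with a changed argument, and a machine is the term of its
  program applied to the terms for its registers. The bound on the domain of \<Delta> ensures that
  the registers being read exist.\<close>

lemma typed_definable_ex:
  "eam_typed M \<alpha> \<Longrightarrow> \<exists>P. pcf_program P \<alpha> \<and> (\<forall>d k. approx \<alpha> d k M P)"
  "regs_typed R \<Delta> \<Longrightarrow> \<exists>Qs. \<forall>d k. env d k \<Delta> R Qs"
  "program_typed r \<Delta> P T \<alpha> \<Longrightarrow> dom \<Delta> \<subseteq> {..<r} \<Longrightarrow> \<exists>N. denotes N r \<Delta> P T \<alpha>"
  "body_typed r \<Delta> A T \<alpha> \<Longrightarrow> dom \<Delta> \<subseteq> {..<r} \<Longrightarrow> \<exists>N. denotes N r \<Delta> (Body A) T \<alpha>"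
  "tape_typed T \<beta>s \<Longrightarrow> \<exists>Qs. \<forall>d k. related d k \<beta>s T Qs"
proof (induction rule: eam_typed_regs_typed_program_typed_body_typed_tape_typed.inducts)
  case (T_num n)
  show ?case using numeral_pcf_typed approx_numeral by blast
next
  case (T_fix \<alpha>)
  \<comment> \<open>The register of this machine leads back to the machine itself, so the rule
    offers no induction hypothesis; the term is given outright and justified by
    \<open>approx_fix\<close>.\<close>
  have "pcf_program (Lam (Fix (Var 0))) ((\<alpha> \<rightarrow>\<^sub>t \<alpha>) \<rightarrow>\<^sub>t \<alpha>)"
    using pcf_typed.intros(1)[of 0 "[\<alpha> \<rightarrow>\<^sub>t \<alpha>]"] by (auto intro!: pcf_typed.intros(3,4))
  moreover have "approx ((\<alpha> \<rightarrow>\<^sub>t \<alpha>) \<rightarrow>\<^sub>t \<alpha>) d k (Y_eam y) (Lam (Fix (Var 0)))" for d k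
  proof -
    have "App (Lam (Fix (Var 0))) Q \<rightarrow>\<^sub>P* Fix Q" for Q
      using beta[of "Fix (Var 0)" Q] by auto
    from approx_expand_right[OF this] show ?thesis
      using approx_fix by (auto simp del: append_tape_simps)
  qed
  ultimately show ?case by blast
next
  case (T_eam R \<Delta> P T \<alpha>)
  then obtain N Qs where N: "denotes N (length R) \<Delta> P T \<alpha>" and e: "\<And>d k. env d k \<Delta> R Qs"
    using regs_typed_dom by blast
  then have "pcf_program (foldl App N Qs) \<alpha>"
    by (auto simp: denotes_def env_def intro!: programs_foldl_App)
  with N e show ?case unfolding denotes_def by blast
next
  case T_regs_Nil
  show ?case by (auto simp: env_def tys_def)
next
  case (T_regs_None R \<Delta>)
  then obtain Qs where e: "\<And>d k. env d k \<Delta> R Qs" by blast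
  have \<Delta>: "\<Delta> i = None" if "\<not> i < length R" for i
    using regs_typed_dom[OF T_regs_None(1)] that by auto
  have "tys (length (R @ [None])) \<Delta> = tys (length R) \<Delta> @ [IntT]"
    using \<Delta> by (simp add: tys_def ty_of_def)
  \<comment> \<open>\<open>Zero\<close> is a dummy of the default type for the uninitialised
    register; \<open>env\<close> asks for nothing more, as \<Delta> is undefined there.\<close>
  moreover have "programs (tys (length R) \<Delta> @ [IntT]) (Qs @ [Zero])"
    using e[of True 0] by (auto simp: env_def intro!: programs_snoc pcf_typed.intros)
  ultimately have "env d k \<Delta> (R @ [None]) (Qs @ [Zero])" for d k
    using e[of d k] env_length[OF e] \<Delta>
    by (auto simp: env_def reads_def nth_append less_Suc_eq)
  then show ?case by blast
next
  case (T_regs_Some R \<Delta> a \<beta>)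
  then obtain Qs Q where e: "\<And>d k. env d k \<Delta> R Qs"
    and Q: "pcf_program Q \<beta>" "\<And>d k. approx \<beta> d k (lookup a) Q" by blast
  have a: "a \<in> typed_addrs \<beta>" using T_regs_Some by (simp add: typed_addrs_def)
  have "tys (length (R @ [Some a])) (\<Delta>(length R \<mapsto> \<beta>)) = tys (length R) \<Delta> @ [\<beta>]"
    by (simp add: tys_def ty_of_def)
  moreover have "programs (tys (length R) \<Delta> @ [\<beta>]) (Qs @ [Q])"
    using e[of True 0] Q(1) by (auto simp: env_def intro!: programs_snoc)
  ultimately have "env d k (\<Delta>(length R \<mapsto> \<beta>)) (R @ [Some a]) (Qs @ [Q])" for d k
    using e[of d k] env_length[OF e] a Q(2)
    by (auto simp: env_def reads_def nth_append less_Suc_eq)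
  then show ?case by blast
next
  case (T_load_empty r \<Delta> i \<beta> P \<alpha>)
  then obtain N where N: "denotes N r (set_ty r \<Delta> i \<beta>) P [] \<alpha>"
    using dom_set_ty_bounded by blast
  let ?\<tau>s = "tys r \<Delta> @ [\<beta>]"
  \<comment> \<open>There are \<open>Suc r\<close> variables in scope: the registers and, innermost,
    the input that is still to come, which goes to position \<open>i\<close>.\<close>
  let ?B = "call_with (Suc r) r N i (Var 0)"
  show ?case
  proof (rule denotesI)
    have "pcf_typed (rev ?\<tau>s) ?B \<alpha>"
      using call_with_typed[of N r ?\<tau>s i \<beta> \<alpha> "Var 0"] N pcf_typed.intros(1)[of 0 "rev ?\<tau>s"]
      by (simp add: denotes_def tys_set_ty)
    then show "pcf_typed (rev (tys r \<Delta>)) (Lam ?B) (\<beta> \<rightarrow>\<^sub>t \<alpha>)"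
      by (simp add: pcf_typed.intros(3))
    fix d k R Qs assume R: "length R = r" and e: "env d k \<Delta> R Qs"
    then have Qs: "programs (tys r \<Delta>) Qs" by (simp add: env_def)
    show "approx (\<beta> \<rightarrow>\<^sub>t \<alpha>) d k (EAM R (Load i P) []) (msubst 0 Qs (Lam ?B))"
      unfolding approx.simps
    proof (intro allI impI ballI)
      fix j a Q assume j: "j \<le> k" and a: "a \<in> typed_addrs \<beta>" "pcf_program Q \<beta>" "approx \<beta> d j (lookup a) Q"
      have QQ: "programs ?\<tau>s (Qs @ [Q])"
        using Qs a(2) by (rule programs_snoc)
      have len: "length Qs = r" using programs_length[OF Qs] by simp
      have "msubst 0 (Qs @ [Q]) (Var 0) = Q"
        using msubst_Var[OF QQ, of r] len by (simp add: nth_append)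
      then have "msubst 0 (Qs @ [Q]) ?B = foldl App N (Qs[i := Q])"
        using call_with_msubst[OF QQ, of r N _ i "Var 0"] N len by (auto simp: denotes_def)
      then have "App (msubst 0 Qs (Lam ?B)) Q \<rightarrow>\<^sub>P foldl App N (Qs[i := Q])"
        using beta[of "msubst 1 Qs ?B" Q] by (simp add: msubst_Lam[OF Qs] msubst_append)
      moreover have "EAM R (Load i P) [] @@ [a] \<rightarrow>\<^sub>c EAM (R[i := Some a]) P []"
        by (simp add: step.Load)
      moreover have "approx \<alpha> d j (EAM (R[i := Some a]) P []) (foldl App N (Qs[i := Q]))"
        using N env_update[OF env_mono[OF e j] a] R by (auto simp: denotes_def)
      ultimately show "approx \<alpha> d j (EAM R (Load i P) [] @@ [a]) (App (msubst 0 Qs (Lam ?B)) Q)"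
        using approx_expand by blast
    qed
  qed
next
  case (T_load a \<beta> r \<Delta> i P T \<alpha>)
  then obtain N Q where N: "denotes N r (set_ty r \<Delta> i \<beta>) P T \<alpha>"
    and Q: "pcf_program Q \<beta>" "\<And>d k. approx \<beta> d k (lookup a) Q"
    using dom_set_ty_bounded by blast
  have a: "a \<in> typed_addrs \<beta>" using T_load(1) by (simp add: typed_addrs_def)
  show ?case
  proof (rule denotesI)
    show "pcf_typed (rev (tys r \<Delta>)) (call_with r r N i Q) \<alpha>"
      using N program_typed_any[OF Q(1)] by (rule denotes_call_with_typed)
    fix d k R Qs assume R: "length R = r" and e: "env d k \<Delta> R Qs"
    have "EAM R (Load i P) (a # T) \<rightarrow>\<^sub>c* EAM (R[i := Some a]) P T"
      using step.Load by auto
    moreover have "approx \<alpha> d k (EAM (R[i := Some a]) P T) (msubst 0 Qs (call_with r r N i Q))"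
      using denotes_call_with[of N R, OF _ e a, where t = Q] N R Q(2) msubst_program[OF Q(1)]
        program_typed_any[OF Q(1)] by simp
    ultimately show "approx \<alpha> d k (EAM R (Load i P) (a # T)) (msubst 0 Qs (call_with r r N i Q))"
      using approx_expand by blast
  qed
next
  case (T_body r \<Delta> A T \<alpha>)
  then show ?case by blast
next
  case (T_app \<Delta> i \<beta> \<gamma> j r k A T \<alpha>)
  then obtain N where N: "denotes N r (set_ty r \<Delta> k \<gamma>) (Body A) T \<alpha>"
    using dom_set_ty_bounded by blast
  have ij: "i < r" "j < r" using T_app by auto
  let ?t = "App (reg r i) (reg r j)"
  have t: "pcf_typed (rev (tys r \<Delta>)) ?t \<gamma>"
    using T_app(1,2) ij by (auto intro: pcf_typed.intros(2) reg_typed)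
  show ?case
  proof (rule denotesI)
    show "pcf_typed (rev (tys r \<Delta>)) (call_with r r N k ?t) \<alpha>"
      using N t by (rule denotes_call_with_typed)
    fix d l R Qs assume R: "length R = r" and e: "env d l \<Delta> R Qs"
    obtain a where a: "reads R i a" "a \<in> typed_addrs (\<beta> \<rightarrow>\<^sub>t \<gamma>)" "approx (\<beta> \<rightarrow>\<^sub>t \<gamma>) d l (lookup a) (Qs ! i)"
      using env_reads[OF e T_app(1)] ij R by blast
    obtain b where b: "reads R j b" "b \<in> typed_addrs \<beta>" "approx \<beta> d l (lookup b) (Qs ! j)"
      using env_reads[OF e T_app(2)] ij R by blast
    have "EAM R (Body (AppI k i j A)) T \<rightarrow>\<^sub>c* EAM (R[k := Some (dot a b)]) (Body A) T"
      using step.App[OF a(1) b(1)] by auto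
    moreover have "approx \<gamma> d l (lookup (dot a b)) (msubst 0 Qs ?t)"
      using a b env_program[OF e T_app(2)] ij R reg_msubst[OF e] by auto
    then have "approx \<alpha> d l (EAM (R[k := Some (dot a b)]) (Body A) T) (msubst 0 Qs (call_with r r N k ?t))"
      using denotes_call_with[of N R, OF _ e typed_addrs_dot[OF a(2) b(2)]] N R t by simp
    ultimately show "approx \<alpha> d l (EAM R (Body (AppI k i j A)) T) (msubst 0 Qs (call_with r r N k ?t))"
      using approx_expand by blast
  qed
next
  case (T_test \<Delta> i j \<beta> k r l A T \<alpha>)
  then obtain N where N: "denotes N r (set_ty r \<Delta> l \<beta>) (Body A) T \<alpha>"
    using dom_set_ty_bounded by blast
  have ijk: "i < r" "j < r" "k < r" using T_test by auto
  \<comment> \<open>The rest of the program is copied into both branches instead of passing an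
    \<open>Ifz\<close> as argument: under call-by-name that argument might never be evaluated,
    whereas the machine always performs the test.\<close>
  let ?B = "\<lambda>j. call_with r r N l (reg r j)"
  show ?case
  proof (rule denotesI)
    show "pcf_typed (rev (tys r \<Delta>)) (Ifz (reg r i) (?B j) (?B k)) \<alpha>"
      using T_test(1-3) ijk by (intro pcf_typed.intros(8) denotes_call_with_typed[OF N] reg_typed)
    fix d m R Qs assume R: "length R = r" and e: "env d m \<Delta> R Qs"
    obtain a where a: "reads R i a" "a \<in> typed_addrs IntT" "approx IntT d m (lookup a) (Qs ! i)"
      using env_reads[OF e T_test(1)] ijk R by blast
    have ri: "msubst 0 Qs (reg r i) = Qs ! i" using reg_msubst[OF e, of i] ijk R by simp
    show "approx \<alpha> d m (EAM R (Body (TestI l i j k A)) T) (msubst 0 Qs (Ifz (reg r i) (?B j) (?B k)))"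
    proof (rule approx_strict[OF strict_at_simps(3) a(1,3)])
      show "msubst 0 Qs (Ifz (reg r i) (?B j) (?B k)) = Ifz (Qs ! i) (msubst 0 Qs (?B j)) (msubst 0 Qs (?B k)) \<or>
        msubst 0 Qs (Ifz (reg r i) (?B j) (?B k)) = Pred (Qs ! i) \<or> msubst 0 Qs (Ifz (reg r i) (?B j) (?B k)) = Succ (Qs ! i)"
        by (simp only: msubst_simps ri simp_thms)
      fix n assume n: "Qs ! i \<rightarrow>\<^sub>P* numeral_pcf n"
      let ?R = "R[i := Some (num n)]"
      define j' where "j' = (if n = 0 then j else k)"
      have e': "env d m \<Delta> ?R Qs" using env_update_num[OF e T_test(1) _ n] ijk R by simp
      have j': "\<Delta> j' = Some \<beta>" "j' < r" using T_test ijk by (auto simp: j'_def)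
      then obtain b where b: "reads ?R j' b" "b \<in> typed_addrs \<beta>" "approx \<beta> d m (lookup b) (Qs ! j')"
        using env_reads[OF e'] R by auto
      have "reads ?R i (num n)" using reads_update[OF a(1)] .
      then have "EAM ?R (Body (TestI l i j k A)) T \<rightarrow>\<^sub>c* EAM (?R[l := Some b]) (Body A) T"
        using b(1) step.Test_zero[of ?R i "num n" j b] step.Test_succ[of ?R i "num n" _ k b]
        by (cases n) (auto simp: j'_def)
      moreover have "Ifz (Qs ! i) (msubst 0 Qs (?B j)) (msubst 0 Qs (?B k)) \<rightarrow>\<^sub>P* msubst 0 Qs (?B j')"
        using Ifz_numeral_steps[OF n, of "msubst 0 Qs (?B j)" "msubst 0 Qs (?B k)"] by (cases "n = 0") (auto simp: j'_def)
      moreover have "approx \<alpha> d m (EAM (?R[l := Some b]) (Body A) T) (msubst 0 Qs (?B j'))"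
        using denotes_call_with[of N ?R, OF _ e' b(2)] N R b(3) reg_typed[of \<Delta> j', OF j'] reg_msubst[OF e', of j'] j'(2)
        by simp
      ultimately show "approx \<alpha> d m (EAM ?R (Body (TestI l i j k A)) T) (msubst 0 Qs (Ifz (reg r i) (?B j) (?B k)))"
        unfolding msubst_simps ri using approx_expand by blast
    qed
  qed
next
  case (T_pred \<Delta> i r k A T \<alpha>)
  then obtain N where N: "denotes N r (set_ty r \<Delta> k IntT) (Body A) T \<alpha>"
    using dom_set_ty_bounded by blast
  have i: "i < r" using T_pred by auto
  \<comment> \<open>The machine evaluates register \<open>i\<close> even if \<open>A\<close> does not use the result; the term has to
    force it as well, by an \<open>Ifz\<close> with equal branches.\<close>
  let ?B = "call_with r r N k (Pred (reg r i))"
  have t: "pcf_typed (rev (tys r \<Delta>)) (Pred (reg r i)) IntT"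
    using T_pred(1) i by (intro pcf_typed.intros reg_typed)
  show ?case
  proof (rule denotesI)
    show "pcf_typed (rev (tys r \<Delta>)) (Ifz (reg r i) ?B ?B) \<alpha>"
      using T_pred(1) i t by (intro pcf_typed.intros(8) denotes_call_with_typed[OF N] reg_typed)
    fix d m R Qs assume R: "length R = r" and e: "env d m \<Delta> R Qs"
    obtain a where a: "reads R i a" "a \<in> typed_addrs IntT" "approx IntT d m (lookup a) (Qs ! i)"
      using env_reads[OF e T_pred(1)] i R by blast
    have ri: "msubst 0 Qs (reg r i) = Qs ! i" using reg_msubst[OF e, of i] i R by simp
    show "approx \<alpha> d m (EAM R (Body (PredI k i A)) T) (msubst 0 Qs (Ifz (reg r i) ?B ?B))"
    proof (rule approx_strict[OF strict_at_simps(1) a(1,3)])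
      show "msubst 0 Qs (Ifz (reg r i) ?B ?B) = Ifz (Qs ! i) (msubst 0 Qs ?B) (msubst 0 Qs ?B) \<or>
        msubst 0 Qs (Ifz (reg r i) ?B ?B) = Pred (Qs ! i) \<or> msubst 0 Qs (Ifz (reg r i) ?B ?B) = Succ (Qs ! i)"
        by (simp only: msubst_simps ri simp_thms)
      fix n assume n: "Qs ! i \<rightarrow>\<^sub>P* numeral_pcf n"
      let ?R = "R[i := Some (num n)]"
      have e': "env d m \<Delta> ?R Qs" using env_update_num[OF e T_pred(1) _ n] i R by simp
      have "EAM ?R (Body (PredI k i A)) T \<rightarrow>\<^sub>c* EAM (?R[k := Some (num (n - 1))]) (Body A) T"
        using step.Pred[OF reads_update[OF a(1)], of "num n" n k A T] by auto
      moreover have "Ifz (Qs ! i) (msubst 0 Qs ?B) (msubst 0 Qs ?B) \<rightarrow>\<^sub>P* msubst 0 Qs ?B"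
        using Ifz_numeral_steps[OF n, of "msubst 0 Qs ?B" "msubst 0 Qs ?B"] by simp
      moreover have "approx IntT d m (lookup (num (n - 1))) (msubst 0 Qs (Pred (reg r i)))"
        unfolding lookup_num msubst_simps ri by (intro approx_numeral Pred_numeral_steps n)
      then have "approx \<alpha> d m (EAM (?R[k := Some (num (n - 1))]) (Body A) T) (msubst 0 Qs ?B)"
        using denotes_call_with[of N ?R, OF _ e', of k IntT "Body A" T \<alpha> "num (n - 1)"] N R t
        by (simp add: typed_addrs_def T_num)
      ultimately show "approx \<alpha> d m (EAM ?R (Body (PredI k i A)) T) (msubst 0 Qs (Ifz (reg r i) ?B ?B))"
        unfolding msubst_simps ri using approx_expand by blast
    qed
  qed
next
  case (T_succ \<Delta> i r k A T \<alpha>)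
  then obtain N where N: "denotes N r (set_ty r \<Delta> k IntT) (Body A) T \<alpha>"
    using dom_set_ty_bounded by blast
  have i: "i < r" using T_succ by auto
  let ?B = "call_with r r N k (Succ (reg r i))"
  have t: "pcf_typed (rev (tys r \<Delta>)) (Succ (reg r i)) IntT"
    using T_succ(1) i by (intro pcf_typed.intros reg_typed)
  show ?case
  proof (rule denotesI)
    show "pcf_typed (rev (tys r \<Delta>)) (Ifz (reg r i) ?B ?B) \<alpha>"
      using T_succ(1) i t by (intro pcf_typed.intros(8) denotes_call_with_typed[OF N] reg_typed)
    fix d m R Qs assume R: "length R = r" and e: "env d m \<Delta> R Qs"
    obtain a where a: "reads R i a" "a \<in> typed_addrs IntT" "approx IntT d m (lookup a) (Qs ! i)"
      using env_reads[OF e T_succ(1)] i R by blast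
    have ri: "msubst 0 Qs (reg r i) = Qs ! i" using reg_msubst[OF e, of i] i R by simp
    show "approx \<alpha> d m (EAM R (Body (SuccI k i A)) T) (msubst 0 Qs (Ifz (reg r i) ?B ?B))"
    proof (rule approx_strict[OF strict_at_simps(2) a(1,3)])
      show "msubst 0 Qs (Ifz (reg r i) ?B ?B) = Ifz (Qs ! i) (msubst 0 Qs ?B) (msubst 0 Qs ?B) \<or>
        msubst 0 Qs (Ifz (reg r i) ?B ?B) = Pred (Qs ! i) \<or> msubst 0 Qs (Ifz (reg r i) ?B ?B) = Succ (Qs ! i)"
        by (simp only: msubst_simps ri simp_thms)
      fix n assume n: "Qs ! i \<rightarrow>\<^sub>P* numeral_pcf n"
      let ?R = "R[i := Some (num n)]"
      have e': "env d m \<Delta> ?R Qs" using env_update_num[OF e T_succ(1) _ n] i R by simp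
      have "EAM ?R (Body (SuccI k i A)) T \<rightarrow>\<^sub>c* EAM (?R[k := Some (num (n + 1))]) (Body A) T"
        using step.Succ[OF reads_update[OF a(1)], of "num n" n k A T] by auto
      moreover have "Ifz (Qs ! i) (msubst 0 Qs ?B) (msubst 0 Qs ?B) \<rightarrow>\<^sub>P* msubst 0 Qs ?B"
        using Ifz_numeral_steps[OF n, of "msubst 0 Qs ?B" "msubst 0 Qs ?B"] by simp
      moreover have "approx IntT d m (lookup (num (n + 1))) (msubst 0 Qs (Succ (reg r i)))"
        unfolding lookup_num msubst_simps ri by (intro approx_numeral Succ_numeral_steps n)
      then have "approx \<alpha> d m (EAM (?R[k := Some (num (n + 1))]) (Body A) T) (msubst 0 Qs ?B)"
        using denotes_call_with[of N ?R, OF _ e', of k IntT "Body A" T \<alpha> "num (n + 1)"] N R t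
        by (simp add: typed_addrs_def T_num)
      ultimately show "approx \<alpha> d m (EAM ?R (Body (SuccI k i A)) T) (msubst 0 Qs (Ifz (reg r i) ?B ?B))"
        unfolding msubst_simps ri using approx_expand by blast
    qed
  qed
next
  case (T_call \<Delta> i \<beta>s \<alpha> T r)
  then obtain Ts where Ts: "\<And>d k. related d k \<beta>s T Ts" by blast
  have i: "i < r" using T_call by auto
  have progs: "programs \<beta>s Ts" using related_programs[OF Ts] .
  then have Ts_typed: "list_all2 (\<lambda>\<tau> Q. pcf_typed \<Gamma> Q \<tau>) \<beta>s Ts" for \<Gamma>
    unfolding programs_def by (rule list_all2_mono) (rule program_typed_any)
  show ?case
  proof (rule denotesI)
    show "pcf_typed (rev (tys r \<Delta>)) (foldl App (reg r i) Ts) \<alpha>"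
      using reg_typed[of \<Delta> i, OF T_call(1) i] Ts_typed by (rule foldl_App_typed)
    fix d k R Qs assume R: "length R = r" and e: "env d k \<Delta> R Qs"
    obtain a where a: "reads R i a" "approx (foldr (\<rightarrow>\<^sub>t) \<beta>s \<alpha>) d k (lookup a) (Qs ! i)"
      using env_reads[OF e T_call(1)] i R by blast
    have "map (msubst 0 Qs) Ts = Ts"
      using progs by (induction rule: programs_induct) auto
    then have "msubst 0 Qs (foldl App (reg r i) Ts) = foldl App (Qs ! i) Ts"
      using reg_msubst[OF e, of i] i R by simp
    moreover have "EAM R (Body (Call i)) T \<rightarrow>\<^sub>c* lookup a @@ T"
      using step.Call[OF a(1)] by auto
    ultimately show "approx \<alpha> d k (EAM R (Body (Call i)) T) (msubst 0 Qs (foldl App (reg r i) Ts))"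
      using approx_expand_left[OF _ approx_apps[OF Ts a(2)]] by simp
  qed
next
  case T_tape_Nil
  show ?case using related_Nil by blast
next
  case (T_tape_Cons a \<beta> T \<beta>s)
  then show ?case using related_Cons unfolding typed_addrs_def by (metis mem_Collect_eq)
qed

subsection \<open>The translation preserves types\<close>

abbreviation arrows :: "ty list \<Rightarrow> ty \<Rightarrow> ty" where
  "arrows \<tau>s \<alpha> \<equiv> foldr (\<rightarrow>\<^sub>t) \<tau>s \<alpha>"

definition loaded :: "(nat \<rightharpoonup> ty) \<Rightarrow> nat \<Rightarrow> ty list \<Rightarrow> nat \<rightharpoonup> ty" where
  "loaded \<Delta> i \<tau>s = (\<lambda>j. if i \<le> j \<and> j < i + length \<tau>s then Some (\<tau>s ! (j - i)) else \<Delta> j)"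

lemma loads_typed_from:
  "i + length \<tau>s \<le> r \<Longrightarrow> body_typed r (loaded \<Delta> i \<tau>s) A [] \<alpha> \<Longrightarrow>
    program_typed r \<Delta> (foldr Load [i..<i + length \<tau>s] (Body A)) [] (arrows \<tau>s \<alpha>)"
proof (induction \<tau>s arbitrary: i \<Delta>)
  case Nil
  have "loaded \<Delta> i [] = \<Delta>" by (rule ext) (auto simp: loaded_def)
  with Nil show ?case by (auto intro: T_body)
next
  case (Cons \<tau> \<tau>s)
  have "loaded (\<Delta>(i \<mapsto> \<tau>)) (Suc i) \<tau>s = loaded \<Delta> i (\<tau> # \<tau>s)"
    by (auto simp: loaded_def fun_eq_iff nth_Cons')
  with Cons.prems(2) have "body_typed r (loaded (\<Delta>(i \<mapsto> \<tau>)) (Suc i) \<tau>s) A [] \<alpha>"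
    by (simp only:)
  from Cons.IH[OF _ this] Cons.prems(1)
  have "program_typed r (\<Delta>(i \<mapsto> \<tau>)) (foldr Load [Suc i..<Suc i + length \<tau>s] (Body A)) [] (arrows \<tau>s \<alpha>)"
    by (simp only: length_Cons add_Suc_right add_Suc)
  moreover have "set_ty r \<Delta> i \<tau> = \<Delta>(i \<mapsto> \<tau>)" using Cons.prems by (simp add: set_ty_def)
  ultimately have "program_typed r \<Delta> (Load i (foldr Load [Suc i..<Suc i + length \<tau>s] (Body A))) [] (\<tau> \<rightarrow>\<^sub>t arrows \<tau>s \<alpha>)"
    by (intro T_load_empty) (simp only:)
  moreover have "[i..<i + length (\<tau> # \<tau>s)] = i # [Suc i..<Suc i + length \<tau>s]"
    by (simp add: upt_conv_Cons del: upt_Suc)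
  ultimately show ?case
    by (simp only: foldr_Cons comp_apply)
qed

text \<open>Since \<open>k < p\<close>, the repeated writes to register \<open>k\<close> leave the
  arguments intact.\<close>

lemma apps_typed:
  "\<Delta> k = Some (arrows \<tau>s \<beta>) \<Longrightarrow> (\<And>i. i < length \<tau>s \<Longrightarrow> \<Delta> (p + i) = Some (\<tau>s ! i)) \<Longrightarrow> k < p \<Longrightarrow> k < r \<Longrightarrow>
    body_typed r (\<Delta>(k \<mapsto> \<beta>)) A T \<alpha> \<Longrightarrow> body_typed r \<Delta> (apps k p (length \<tau>s) A) T \<alpha>"
proof (induction \<tau>s arbitrary: \<Delta> p)
  case Nil
  then have "\<Delta>(k \<mapsto> \<beta>) = \<Delta>" by auto
  with Nil show ?case by (simp add: apps_def)
next
  case (Cons \<tau> \<tau>s)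
  have "apps k p (length (\<tau> # \<tau>s)) A = AppI k k p (apps k (Suc p) (length \<tau>s) A)"
    by (simp add: apps_def upt_conv_Cons del: upt_Suc)
  moreover have "body_typed r (\<Delta>(k \<mapsto> arrows \<tau>s \<beta>)) (apps k (Suc p) (length \<tau>s) A) T \<alpha>"
  proof (rule Cons.IH)
    show "(\<Delta>(k \<mapsto> arrows \<tau>s \<beta>)) (Suc p + i) = Some (\<tau>s ! i)" if "i < length \<tau>s" for i
      using Cons.prems(2)[of "Suc i"] Cons.prems(3) that by simp
    show "body_typed r (\<Delta>(k \<mapsto> arrows \<tau>s \<beta>, k \<mapsto> \<beta>)) A T \<alpha>"
      unfolding fun_upd_upd by (rule Cons.prems(5))
  qed (use Cons.prems in simp_all)
  ultimately show ?case
    using Cons.prems(1,4) Cons.prems(2)[of 0] T_app[of \<Delta> k \<tau> "arrows \<tau>s \<beta>" p r k] by (simp add: set_ty_def)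
qed

lemma regs_typed_replicate: "regs_typed (replicate n None) Map.empty"
proof (induction n)
  case (Suc n)
  then show ?case
    using T_regs_None[of "replicate n None" Map.empty] by (simp add: replicate_append_same)
qed (simp add: T_regs_Nil)

lemma loads_typed:
  assumes "body_typed (length \<tau>s) (loaded Map.empty 0 \<tau>s) A [] \<alpha>"
  shows "eam_typed (EAM (replicate (length \<tau>s) None) (loads (length \<tau>s) A) []) (arrows \<tau>s \<alpha>)"
  using T_eam[OF regs_typed_replicate] loads_typed_from[of 0 \<tau>s "length \<tau>s" Map.empty A \<alpha>] assms
  by (simp add: loads_def)

lemma Pr_typed: "i < length \<tau>s \<Longrightarrow> eam_typed (Pr (length \<tau>s) i) (arrows \<tau>s (\<tau>s ! i))"
  unfolding Pr_def by (intro loads_typed T_call[where \<beta>s = "[]"] T_tape_Nil) (simp add: loaded_def)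

lemma Apply_n_typed:
  "eam_typed (Apply_n (length \<tau>s)) (arrows \<tau>s (\<alpha> \<rightarrow>\<^sub>t \<beta>) \<rightarrow>\<^sub>t arrows \<tau>s \<alpha> \<rightarrow>\<^sub>t arrows \<tau>s \<beta>)"
proof -
  let ?\<sigma>s = "arrows \<tau>s (\<alpha> \<rightarrow>\<^sub>t \<beta>) # arrows \<tau>s \<alpha> # \<tau>s"
  let ?n = "length \<tau>s"
  have "body_typed (length ?\<sigma>s) (loaded Map.empty 0 ?\<sigma>s) (apps 0 2 ?n (apps 1 2 ?n (AppI 0 0 1 (Call 0)))) [] \<beta>"
    by (intro apps_typed[where \<beta> = "\<alpha> \<rightarrow>\<^sub>t \<beta>"] apps_typed[where \<beta> = \<alpha>] T_app[where \<beta> = \<alpha> and \<gamma> = \<beta>]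
        T_call[where \<beta>s = "[]"] T_tape_Nil)
      (auto simp: loaded_def set_ty_def)
  from loads_typed[OF this] show ?thesis by (simp add: Apply_n_def)
qed

lemma Pred_n_typed: "eam_typed (Pred_n (length \<tau>s)) (arrows \<tau>s IntT \<rightarrow>\<^sub>t arrows \<tau>s IntT)"
proof -
  let ?\<sigma>s = "arrows \<tau>s IntT # \<tau>s"
  have "body_typed (length ?\<sigma>s) (loaded Map.empty 0 ?\<sigma>s) (apps 0 1 (length \<tau>s) (PredI 0 0 (Call 0))) [] IntT"
    by (intro apps_typed[where \<beta> = IntT] T_pred T_call[where \<beta>s = "[]"] T_tape_Nil)
      (auto simp: loaded_def set_ty_def)
  from loads_typed[OF this] show ?thesis by (simp add: Pred_n_def)
qed

lemma Succ_n_typed: "eam_typed (Succ_n (length \<tau>s)) (arrows \<tau>s IntT \<rightarrow>\<^sub>t arrows \<tau>s IntT)"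
proof -
  let ?\<sigma>s = "arrows \<tau>s IntT # \<tau>s"
  have "body_typed (length ?\<sigma>s) (loaded Map.empty 0 ?\<sigma>s) (apps 0 1 (length \<tau>s) (SuccI 0 0 (Call 0))) [] IntT"
    by (intro apps_typed[where \<beta> = IntT] T_succ T_call[where \<beta>s = "[]"] T_tape_Nil)
      (auto simp: loaded_def set_ty_def)
  from loads_typed[OF this] show ?thesis by (simp add: Succ_n_def)
qed

lemma Ifz_n_typed:
  "eam_typed (Ifz_n (length \<tau>s)) (arrows \<tau>s IntT \<rightarrow>\<^sub>t arrows \<tau>s \<alpha> \<rightarrow>\<^sub>t arrows \<tau>s \<alpha> \<rightarrow>\<^sub>t arrows \<tau>s \<alpha>)"
proof -
  let ?\<sigma>s = "arrows \<tau>s IntT # arrows \<tau>s \<alpha> # arrows \<tau>s \<alpha> # \<tau>s"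
  let ?n = "length \<tau>s"
  have "body_typed (length ?\<sigma>s) (loaded Map.empty 0 ?\<sigma>s)
      (apps 0 3 ?n (apps 1 3 ?n (apps 2 3 ?n (TestI 0 0 1 2 (Call 0))))) [] \<alpha>"
    by (intro apps_typed[where k = 0 and \<beta> = IntT] apps_typed[where \<beta> = \<alpha>] T_test[where \<beta> = \<alpha>]
        T_call[where \<beta>s = "[]"] T_tape_Nil)
      (auto simp: loaded_def set_ty_def numeral_2_eq_2)
  from loads_typed[OF this] show ?thesis by (simp add: Ifz_n_def eval_nat_numeral)
qed

lemma Fix_n_typed: "eam_typed (Fix_n (length \<tau>s)) (arrows \<tau>s (\<alpha> \<rightarrow>\<^sub>t \<alpha>) \<rightarrow>\<^sub>t arrows \<tau>s \<alpha>)"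
proof -
  let ?\<sigma>s = "arrows \<tau>s (\<alpha> \<rightarrow>\<^sub>t \<alpha>) # \<tau>s"
  \<comment> \<open>Register \<open>n + 1\<close> is never loaded but holds the fixed point machine
    from the start, so its type has to be present before the loads.\<close>
  let ?n = "length \<tau>s" and ?\<Delta> = "[Suc (length \<tau>s) \<mapsto> (\<alpha> \<rightarrow>\<^sub>t \<alpha>) \<rightarrow>\<^sub>t \<alpha>]"
  have "body_typed (?n + 2) (loaded ?\<Delta> 0 ?\<sigma>s) (apps 0 1 ?n (AppI 0 (?n + 1) 0 (Call 0))) [] \<alpha>"
    by (intro apps_typed[where \<beta> = "\<alpha> \<rightarrow>\<^sub>t \<alpha>"] T_app[where \<beta> = "\<alpha> \<rightarrow>\<^sub>t \<alpha>" and \<gamma> = \<alpha>]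
        T_call[where \<beta>s = "[]"] T_tape_Nil)
      (auto simp: loaded_def set_ty_def)
  then have "program_typed (?n + 2) ?\<Delta> (loads (?n + 1) (apps 0 1 ?n (AppI 0 (?n + 1) 0 (Call 0)))) [] (arrows ?\<sigma>s \<alpha>)"
    using loads_typed_from[of 0 ?\<sigma>s "?n + 2" ?\<Delta>] by (simp add: loads_def)
  moreover have "regs_typed (replicate (?n + 1) None @ [Some y]) ?\<Delta>"
    using T_regs_Some[OF regs_typed_replicate[of "Suc ?n"], of y] T_fix by simp
  ultimately show ?thesis
    unfolding Fix_n_def using T_eam by fastforce
qed

lemma eam_typed_app_addr:
  "eam_typed M (\<alpha> \<rightarrow>\<^sub>t \<beta>) \<Longrightarrow> eam_typed N \<alpha> \<Longrightarrow> eam_typed (M @@ [addr N]) \<beta>"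
  by (rule eam_typed_snoc) (auto simp: lookup_addr typed_valid(1))

text \<open>The environment is reversed because its head is the innermost variable, whose value
  comes last on the tape. With this order an abstraction and its body have the same machine and the
  same type.\<close>

lemma translate_typed: "pcf_typed \<Gamma> P \<alpha> \<Longrightarrow> eam_typed (translate (length \<Gamma>) P) (arrows (rev \<Gamma>) \<alpha>)"
proof (induction rule: pcf_typed.induct)
  case (1 i \<Gamma>)
  then show ?case using Pr_typed[of "length \<Gamma> - 1 - i" "rev \<Gamma>"] by (simp add: rev_nth)
next
  case (2 \<Gamma> P \<alpha> \<beta> Q)
  let ?t = "\<lambda>P. addr (translate (length \<Gamma>) P)"
  have "eam_typed (Apply_n (length \<Gamma>) @@ [?t P] @@ [?t Q]) (arrows (rev \<Gamma>) \<beta>)"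
    using 2 Apply_n_typed[of "rev \<Gamma>" \<alpha> \<beta>] by (intro eam_typed_app_addr) auto
  then show ?case by simp
next
  case (4 \<Gamma> P \<alpha>)
  with Fix_n_typed[of "rev \<Gamma>" \<alpha>] show ?case by (auto intro: eam_typed_app_addr)
next
  case (5 \<Gamma>)
  show ?case
    using Pr_typed[of 0 "IntT # rev \<Gamma>"] eam_typed_app_addr[of _ IntT _ "numeral_eam num 0"] T_num
    by (simp add: addr_numeral)
next
  case (6 \<Gamma> P)
  with Pred_n_typed[of "rev \<Gamma>"] show ?case by (auto intro: eam_typed_app_addr)
next
  case (7 \<Gamma> P)
  with Succ_n_typed[of "rev \<Gamma>"] show ?case by (auto intro: eam_typed_app_addr)
next
  case (8 \<Gamma> L P \<alpha> Q)
  let ?t = "\<lambda>P. addr (translate (length \<Gamma>) P)"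
  have "eam_typed (Ifz_n (length \<Gamma>) @@ [?t L] @@ [?t P] @@ [?t Q]) (arrows (rev \<Gamma>) \<alpha>)"
    using 8 Ifz_n_typed[of "rev \<Gamma>" \<alpha>] by (intro eam_typed_app_addr) auto
  then show ?case by simp
qed simp

subsection \<open>The translation of a program approximates it and conversely\<close>

lemma lookup_dots [simp]: "lookup (foldl dot a as) = lookup a @@ as"
  by (induction as arbitrary: a) auto

lemma loads_steps_from:
  "EAM (Rs @ replicate (length as) None @ R) (foldr Load [length Rs..<length Rs + length as] (Body A)) (as @ T)
    \<rightarrow>\<^sub>c* EAM (Rs @ map Some as @ R) (Body A) T"
proof (induction as arbitrary: Rs)
  case (Cons a as)
  have "[length Rs..<length Rs + length (a # as)] = length Rs # [Suc (length Rs)..<Suc (length Rs) + length as]"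
    by (simp add: upt_conv_Cons del: upt_Suc)
  moreover have "EAM (Rs @ replicate (length (a # as)) None @ R) (Load (length Rs) P) ((a # as) @ T)
    \<rightarrow>\<^sub>c EAM ((Rs @ [Some a]) @ replicate (length as) None @ R) P (as @ T)" for P
    using step.Load[of "Rs @ replicate (length (a # as)) None @ R" "length Rs" P a "as @ T"]
    by (simp add: list_update_append)
  ultimately show ?case
    using Cons.IH[of "Rs @ [Some a]"]
    by (auto simp del: upt_Suc intro: converse_rtranclp_into_rtranclp)
qed simp

lemma loads_steps:
  "length as = m \<Longrightarrow> EAM (replicate m None @ R) (loads m A) [] @@ as \<rightarrow>\<^sub>c* EAM (map Some as @ R) (Body A) []"
  using loads_steps_from[of "[]" as R A "[]"] by (simp add: loads_def)

lemma apps_steps: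
  "reads R k a \<Longrightarrow> (\<And>i. i < length as \<Longrightarrow> reads R (p + i) (as ! i)) \<Longrightarrow> k < p \<Longrightarrow>
    EAM R (Body (apps k p (length as) A)) T \<rightarrow>\<^sub>c* EAM (R[k := Some (foldl dot a as)]) (Body A) T"
proof (induction as arbitrary: R p a)
  case Nil
  then have "R[k := Some a] = R" unfolding reads_def by (metis list_update_id)
  then show ?case by (simp add: apps_def)
next
  case (Cons b as)
  have "apps k p (length (b # as)) A = AppI k k p (apps k (Suc p) (length as) A)"
    by (simp add: apps_def upt_conv_Cons del: upt_Suc)
  moreover have "EAM R (Body (AppI k k p B)) T \<rightarrow>\<^sub>c EAM (R[k := Some (dot a b)]) (Body B) T" for B
    using step.App[OF Cons.prems(1)] Cons.prems(2)[of 0] by simp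
  moreover have "EAM (R[k := Some (dot a b)]) (Body (apps k (Suc p) (length as) A)) T
    \<rightarrow>\<^sub>c* EAM (R[k := Some (dot a b), k := Some (foldl dot (dot a b) as)]) (Body A) T"
  proof (rule Cons.IH)
    show "reads (R[k := Some (dot a b)]) k (dot a b)" using reads_update[OF Cons.prems(1)] .
    show "reads (R[k := Some (dot a b)]) (Suc p + i) (as ! i)" if "i < length as" for i
      using Cons.prems(2)[of "Suc i"] Cons.prems(3) that by (auto simp: reads_def)
  qed (use Cons.prems in simp)
  ultimately show ?case
    by (auto intro: converse_rtranclp_into_rtranclp)
qed

lemmas steps_trans = rtranclp_trans[of step]

lemma Call_steps: "reads R i a \<Longrightarrow> EAM R (Body (Call i)) T \<rightarrow>\<^sub>c* lookup a @@ T"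
  by (rule r_into_rtranclp) (rule step.Call)

lemma AppI_steps:
  "reads R i a \<Longrightarrow> reads R j b \<Longrightarrow> R' = R[k := Some (dot a b)] \<Longrightarrow>
    EAM R (Body (AppI k i j A)) T \<rightarrow>\<^sub>c* EAM R' (Body A) T"
  by (auto intro: step.App)

lemma PredI_steps:
  "reads R i (num n) \<Longrightarrow> R' = R[k := Some (num (n - 1))] \<Longrightarrow>
    EAM R (Body (PredI k i A)) T \<rightarrow>\<^sub>c* EAM R' (Body A) T"
  using step.Pred[of R i "num n" n] by auto

lemma SuccI_steps:
  "reads R i (num n) \<Longrightarrow> R' = R[k := Some (num (n + 1))] \<Longrightarrow>
    EAM R (Body (SuccI k i A)) T \<rightarrow>\<^sub>c* EAM R' (Body A) T"
  using step.Succ[of R i "num n" n] by auto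

lemma TestI_steps:
  "reads R i (num n) \<Longrightarrow> reads R (if n = 0 then j else k) b \<Longrightarrow> R' = R[l := Some b] \<Longrightarrow>
    EAM R (Body (TestI l i j k A)) T \<rightarrow>\<^sub>c* EAM R' (Body A) T"
  using step.Test_zero[of R i "num n" j b] step.Test_succ[of R i "num n" "n - 1" k b] by (cases n) auto

lemma Pr_steps:
  assumes "i < length as"
  shows "Pr (length as) i @@ as \<rightarrow>\<^sub>c* lookup (as ! i)"
proof -
  have "Pr (length as) i @@ as \<rightarrow>\<^sub>c* EAM (map Some as) (Body (Call i)) []"
    using loads_steps[of as "length as" "[]" "Call i"] by (simp add: Pr_def)
  also have "\<dots> \<rightarrow>\<^sub>c* lookup (as ! i) @@ []"
    using assms by (intro Call_steps) (simp add: reads_def)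
  finally (steps_trans) show ?thesis by simp
qed

lemma Apply_n_steps:
  "Apply_n (length as) @@ ([a, b] @ as) \<rightarrow>\<^sub>c* lookup a @@ as @@ [foldl dot b as]"
proof -
  let ?n = "length as" and ?a = "foldl dot a as" and ?b = "foldl dot b as"
  let ?A = "AppI 0 0 1 (Call 0)" and ?R = "map Some as"
  have "Apply_n ?n @@ ([a, b] @ as) \<rightarrow>\<^sub>c*
      EAM (Some a # Some b # ?R) (Body (apps 0 2 ?n (apps 1 2 ?n ?A))) []"
    using loads_steps[of "[a, b] @ as" "?n + 2" "[]"] by (simp add: Apply_n_def)
  also have "\<dots> \<rightarrow>\<^sub>c* EAM (Some ?a # Some b # ?R) (Body (apps 1 2 ?n ?A)) []"
    using apps_steps[of "Some a # Some b # ?R" 0 a as 2] by (simp add: reads_def)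
  also (steps_trans) have "\<dots> \<rightarrow>\<^sub>c* EAM (Some ?a # Some ?b # ?R) (Body ?A) []"
    using apps_steps[of "Some ?a # Some b # ?R" 1 b as 2] by (simp add: reads_def)
  also (steps_trans) have "\<dots> \<rightarrow>\<^sub>c* EAM (Some (dot ?a ?b) # Some ?b # ?R) (Body (Call 0)) []"
    by (rule AppI_steps[where a = ?a and b = ?b]) (simp_all add: reads_def)
  also (steps_trans) have "\<dots> \<rightarrow>\<^sub>c* lookup (dot ?a ?b) @@ []"
    by (rule Call_steps) (simp add: reads_def)
  finally (steps_trans) show ?thesis by simp
qed

text \<open>The run stops at the strict instruction, whose argument need not have a value;
  \<open>approx_strict\<close> takes over from there. The same holds for the successor and the
  test.\<close>

lemma Pred_n_steps:
  "Pred_n (length as) @@ (a # as) \<rightarrow>\<^sub>c* EAM (Some (foldl dot a as) # map Some as) (Body (PredI 0 0 (Call 0))) []"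
proof -
  have "Pred_n (length as) @@ (a # as) \<rightarrow>\<^sub>c* EAM (Some a # map Some as) (Body (apps 0 1 (length as) (PredI 0 0 (Call 0)))) []"
    using loads_steps[of "a # as" "length as + 1" "[]"] by (simp add: Pred_n_def)
  also have "\<dots> \<rightarrow>\<^sub>c* EAM (Some (foldl dot a as) # map Some as) (Body (PredI 0 0 (Call 0))) []"
    using apps_steps[of "Some a # map Some as" 0 a as 1] by (simp add: reads_def)
  finally (steps_trans) show ?thesis .
qed

lemma Succ_n_steps:
  "Succ_n (length as) @@ (a # as) \<rightarrow>\<^sub>c* EAM (Some (foldl dot a as) # map Some as) (Body (SuccI 0 0 (Call 0))) []"
proof -
  have "Succ_n (length as) @@ (a # as) \<rightarrow>\<^sub>c* EAM (Some a # map Some as) (Body (apps 0 1 (length as) (SuccI 0 0 (Call 0)))) []"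
    using loads_steps[of "a # as" "length as + 1" "[]"] by (simp add: Succ_n_def)
  also have "\<dots> \<rightarrow>\<^sub>c* EAM (Some (foldl dot a as) # map Some as) (Body (SuccI 0 0 (Call 0))) []"
    using apps_steps[of "Some a # map Some as" 0 a as 1] by (simp add: reads_def)
  finally (steps_trans) show ?thesis .
qed

lemma Ifz_n_steps:
  "Ifz_n (length as) @@ ([a, b, c] @ as) \<rightarrow>\<^sub>c*
    EAM (Some (foldl dot a as) # Some (foldl dot b as) # Some (foldl dot c as) # map Some as)
      (Body (TestI 0 0 1 2 (Call 0))) []"
proof -
  let ?n = "length as" and ?a = "foldl dot a as" and ?b = "foldl dot b as" and ?c = "foldl dot c as"
  let ?A = "TestI 0 0 1 2 (Call 0)" and ?R = "map Some as"
  have "Ifz_n ?n @@ ([a, b, c] @ as) \<rightarrow>\<^sub>c*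
      EAM (Some a # Some b # Some c # ?R) (Body (apps 0 3 ?n (apps 1 3 ?n (apps 2 3 ?n ?A)))) []"
    using loads_steps[of "[a, b, c] @ as" "?n + 3" "[]"] by (simp add: Ifz_n_def)
  also have "\<dots> \<rightarrow>\<^sub>c* EAM (Some ?a # Some b # Some c # ?R) (Body (apps 1 3 ?n (apps 2 3 ?n ?A))) []"
    using apps_steps[of "Some a # Some b # Some c # ?R" 0 a as 3] by (simp add: reads_def)
  also (steps_trans) have "\<dots> \<rightarrow>\<^sub>c* EAM (Some ?a # Some ?b # Some c # ?R) (Body (apps 2 3 ?n ?A)) []"
    using apps_steps[of "Some ?a # Some b # Some c # ?R" 1 b as 3] by (simp add: reads_def)
  also (steps_trans) have "\<dots> \<rightarrow>\<^sub>c* EAM (Some ?a # Some ?b # Some ?c # ?R) (Body ?A) []"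
    using apps_steps[of "Some ?a # Some ?b # Some c # ?R" 2 c as 3]
    by (simp add: reads_def eval_nat_numeral)
  finally (steps_trans) show ?thesis .
qed

lemma Fix_n_steps: "Fix_n (length as) @@ (a # as) \<rightarrow>\<^sub>c* Y_eam y @@ [foldl dot a as]"
proof -
  let ?n = "length as" and ?a = "foldl dot a as"
  let ?R = "map Some as @ [Some y]"
  have "Fix_n ?n @@ (a # as) \<rightarrow>\<^sub>c* EAM (Some a # ?R) (Body (apps 0 1 ?n (AppI 0 (?n + 1) 0 (Call 0)))) []"
    using loads_steps[of "a # as" "?n + 1" "[Some y]"] by (simp add: Fix_n_def)
  also have "\<dots> \<rightarrow>\<^sub>c* EAM (Some ?a # ?R) (Body (AppI 0 (?n + 1) 0 (Call 0))) []"
    using apps_steps[of "Some a # ?R" 0 a as 1] by (simp add: reads_def nth_append)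
  also (steps_trans) have "\<dots> \<rightarrow>\<^sub>c* EAM (Some (dot y ?a) # ?R) (Body (Call 0)) []"
    by (rule AppI_steps[where a = y and b = ?a]) (simp_all add: reads_def nth_append)
  also (steps_trans) have "\<dots> \<rightarrow>\<^sub>c* lookup (dot y ?a) @@ []"
    by (rule Call_steps) (simp add: reads_def)
  finally (steps_trans) show ?thesis by simp
qed

text \<open>The fundamental lemma, for open terms under related values of their variables. The index
  is generalised because the case of abstraction moves to a smaller one; there the new argument
  simply joins the tape and the substitution.\<close>

lemma translate_approx:
  "pcf_typed \<Gamma> P \<alpha> \<Longrightarrow> related d k (rev \<Gamma>) as Qs \<Longrightarrow> approx \<alpha> d k (translate (length \<Gamma>) P @@ as) (msubst 0 Qs P)"
proof (induction arbitrary: k as Qs rule: pcf_typed.induct)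
  case (1 i \<Gamma>)
  let ?i = "length \<Gamma> - 1 - i"
  have Qs: "programs (rev \<Gamma>) Qs" "length as = length \<Gamma>" "length Qs = length \<Gamma>"
    using related_programs[OF 1(2)] related_length[OF 1(2)] programs_length by fastforce+
  have "msubst 0 Qs (Var i) = Qs ! ?i"
    using msubst_Var[OF Qs(1), of ?i] 1(1) Qs(3) by simp
  moreover have "approx (\<Gamma> ! i) d k (lookup (as ! ?i)) (Qs ! ?i)"
    using related_nth[OF 1(2), of ?i] 1(1) by (simp add: rev_nth)
  moreover have "translate (length \<Gamma>) (Var i) @@ as \<rightarrow>\<^sub>c* lookup (as ! ?i)"
    using Pr_steps[of ?i as] 1(1) Qs(2) by simp
  ultimately show ?case using approx_expand_left by metis
next
  case (2 \<Gamma> P \<alpha> \<beta> Q)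
  let ?t = "translate (length \<Gamma>)"
  have t: "eam_typed (?t P) (arrows (rev \<Gamma>) (\<alpha> \<rightarrow>\<^sub>t \<beta>))" "eam_typed (?t Q) (arrows (rev \<Gamma>) \<alpha>)"
    using translate_typed 2(1,2) by blast+
  note l = lookup_addr[OF typed_valid(1)[OF t(1)]] lookup_addr[OF typed_valid(1)[OF t(2)]]
  have "translate (length \<Gamma>) (App P Q) @@ as \<rightarrow>\<^sub>c* ?t P @@ as @@ [foldl dot (addr (?t Q)) as]"
    using Apply_n_steps[of as "addr (?t P)" "addr (?t Q)"] related_length[OF 2(5)] l(1) by simp
  moreover have "foldl dot (addr (?t Q)) as \<in> typed_addrs \<alpha>"
    using eam_typed_apps[OF 2(5) t(2)] l(2) by (simp add: typed_addrs_def)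
  then have "approx \<beta> d k (?t P @@ as @@ [foldl dot (addr (?t Q)) as]) (msubst 0 Qs (App P Q))"
    using 2(3)[OF 2(5)] 2(4)[OF 2(5)] msubst_typed[OF related_programs[OF 2(5)]] 2(2) l(2) by simp
  ultimately show ?case by (rule approx_expand_left)
next
  case (3 \<alpha> \<Gamma> P \<beta>)
  show ?case
    unfolding approx.simps
  proof (intro allI impI ballI)
    fix j a Q assume j: "j \<le> k" and a: "a \<in> typed_addrs \<alpha>" "pcf_program Q \<alpha>" "approx \<alpha> d j (lookup a) Q"
    have *: "approx \<beta> d j (translate (length (\<alpha> # \<Gamma>)) P @@ (as @ [a])) (msubst 0 (Qs @ [Q]) P)"
      using 3(2)[of j] related_snoc[OF related_mono[OF 3(3) j] a] by simp
    have "App (msubst 0 Qs (Lam P)) Q \<rightarrow>\<^sub>P* msubst 0 (Qs @ [Q]) P"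
      by (rule r_into_rtranclp) (use beta[of "msubst 1 Qs P" Q] in \<open>simp add: msubst_Lam[OF related_programs[OF 3(3)]] msubst_append\<close>)
    from approx_expand_right[OF this *] show "approx \<beta> d j (translate (length \<Gamma>) (Lam P) @@ as @@ [a]) (App (msubst 0 Qs (Lam P)) Q)"
      by (simp only: append_tape_simps(3) translate.simps length_Cons)
  qed
next
  case (4 \<Gamma> P \<alpha>)
  let ?t = "translate (length \<Gamma>)"
  have t: "eam_typed (?t P) (arrows (rev \<Gamma>) (\<alpha> \<rightarrow>\<^sub>t \<alpha>))" using translate_typed 4(1) by blast
  note l = lookup_addr[OF typed_valid(1)[OF t]]
  let ?a = "foldl dot (addr (?t P)) as"
  have "?t (Fix P) @@ as \<rightarrow>\<^sub>c* Y_eam y @@ [?a]"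
    using Fix_n_steps[of as "addr (?t P)"] related_length[OF 4(3)] by simp
  moreover have "?a \<in> typed_addrs (\<alpha> \<rightarrow>\<^sub>t \<alpha>)"
    using eam_typed_apps[OF 4(3) t] l by (simp add: typed_addrs_def)
  then have "approx \<alpha> d k (Y_eam y @@ [?a]) (msubst 0 Qs (Fix P))"
    unfolding msubst_simps using 4(2)[OF 4(3)] msubst_typed[OF related_programs[OF 4(3)], of P] 4(1) l
    by (intro approx_fix) (auto simp del: approx.simps)
  ultimately show ?case by (rule approx_expand_left)
next
  case (5 \<Gamma>)
  have "translate (length \<Gamma>) Zero @@ as \<rightarrow>\<^sub>c* numeral_eam num 0"
    using Pr_steps[of 0 "num 0 # as"] related_length[OF 5] by simp
  moreover have "approx IntT d k (numeral_eam num 0) Zero"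
    by (rule approx_numeral) simp
  ultimately show ?case
    unfolding msubst_simps by (rule approx_expand_left)
next
  case (6 \<Gamma> P)
  let ?t = "translate (length \<Gamma>)"
  have t: "eam_typed (?t P) (arrows (rev \<Gamma>) IntT)" using translate_typed 6(1) by blast
  note l = lookup_addr[OF typed_valid(1)[OF t]]
  let ?a = "foldl dot (addr (?t P)) as" and ?I = "PredI 0 0 (Call 0)"
  let ?R = "Some ?a # map Some as"
  have "?t (Pred P) @@ as \<rightarrow>\<^sub>c* EAM ?R (Body ?I) []"
    using Pred_n_steps[of as "addr (?t P)"] related_length[OF 6(3)] by simp
  moreover have "approx IntT d k (EAM ?R (Body ?I) []) (Pred (msubst 0 Qs P))"
  proof (rule approx_strict[where i = 0 and L = "msubst 0 Qs P"])
    show "reads ?R 0 ?a" by (simp add: reads_def)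
    show "approx IntT d k (lookup ?a) (msubst 0 Qs P)" using 6(2)[OF 6(3)] l by simp
    fix n assume n: "msubst 0 Qs P \<rightarrow>\<^sub>P* numeral_pcf n"
    have "EAM (Some (num n) # map Some as) (Body ?I) [] \<rightarrow>\<^sub>c* EAM (Some (num (n - 1)) # map Some as) (Body (Call 0)) []"
      by (rule PredI_steps[where n = n]) (simp_all add: reads_def)
    also have "\<dots> \<rightarrow>\<^sub>c* lookup (num (n - 1)) @@ []"
      by (rule Call_steps) (simp add: reads_def)
    finally (steps_trans) have "EAM (?R[0 := Some (num n)]) (Body ?I) [] \<rightarrow>\<^sub>c* numeral_eam num (n - 1)" by simp
    then show "approx IntT d k (EAM (?R[0 := Some (num n)]) (Body ?I) []) (Pred (msubst 0 Qs P))"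
      using Pred_numeral_steps[OF n] approx_numeral[OF rtranclp.rtrancl_refl] by (rule approx_expand)
  qed auto
  ultimately show ?case
    unfolding msubst_simps by (rule approx_expand_left)
next
  case (7 \<Gamma> P)
  let ?t = "translate (length \<Gamma>)"
  have t: "eam_typed (?t P) (arrows (rev \<Gamma>) IntT)" using translate_typed 7(1) by blast
  note l = lookup_addr[OF typed_valid(1)[OF t]]
  let ?a = "foldl dot (addr (?t P)) as" and ?I = "SuccI 0 0 (Call 0)"
  let ?R = "Some ?a # map Some as"
  have "?t (Succ P) @@ as \<rightarrow>\<^sub>c* EAM ?R (Body ?I) []"
    using Succ_n_steps[of as "addr (?t P)"] related_length[OF 7(3)] by simp
  moreover have "approx IntT d k (EAM ?R (Body ?I) []) (Succ (msubst 0 Qs P))"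
  proof (rule approx_strict[where i = 0 and L = "msubst 0 Qs P"])
    show "reads ?R 0 ?a" by (simp add: reads_def)
    show "approx IntT d k (lookup ?a) (msubst 0 Qs P)" using 7(2)[OF 7(3)] l by simp
    fix n assume n: "msubst 0 Qs P \<rightarrow>\<^sub>P* numeral_pcf n"
    have "EAM (Some (num n) # map Some as) (Body ?I) [] \<rightarrow>\<^sub>c* EAM (Some (num (n + 1)) # map Some as) (Body (Call 0)) []"
      by (rule SuccI_steps[where n = n]) (simp_all add: reads_def)
    also have "\<dots> \<rightarrow>\<^sub>c* lookup (num (n + 1)) @@ []"
      by (rule Call_steps) (simp add: reads_def)
    finally (steps_trans) have "EAM (?R[0 := Some (num n)]) (Body ?I) [] \<rightarrow>\<^sub>c* numeral_eam num (n + 1)" by simp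
    then show "approx IntT d k (EAM (?R[0 := Some (num n)]) (Body ?I) []) (Succ (msubst 0 Qs P))"
      using Succ_numeral_steps[OF n] approx_numeral[OF rtranclp.rtrancl_refl] by (rule approx_expand)
  qed auto
  ultimately show ?case
    unfolding msubst_simps by (rule approx_expand_left)
next
  case (8 \<Gamma> L P \<alpha> Q)
  let ?t = "translate (length \<Gamma>)"
  have t: "eam_typed (?t L) (arrows (rev \<Gamma>) IntT)" "eam_typed (?t P) (arrows (rev \<Gamma>) \<alpha>)"
      "eam_typed (?t Q) (arrows (rev \<Gamma>) \<alpha>)"
    using translate_typed 8(1-3) by blast+
  note l = t[THEN typed_valid(1), THEN lookup_addr]
  let ?d = "\<lambda>P. foldl dot (addr (?t P)) as" and ?s = "msubst 0 Qs"
  let ?I = "TestI 0 0 1 2 (Call 0)"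
  let ?R = "\<lambda>a. Some a # Some (?d P) # Some (?d Q) # map Some as"
  have "?t (Ifz L P Q) @@ as \<rightarrow>\<^sub>c* EAM (?R (?d L)) (Body ?I) []"
    using Ifz_n_steps[of as] related_length[OF 8(7)] by simp
  moreover have "approx \<alpha> d k (EAM (?R (?d L)) (Body ?I) []) (Ifz (?s L) (?s P) (?s Q))"
  proof (rule approx_strict[where i = 0 and L = "?s L" and A = "?s P" and B = "?s Q"])
    show "reads (?R (?d L)) 0 (?d L)" by (simp add: reads_def)
    show "approx IntT d k (lookup (?d L)) (?s L)" using 8(4)[OF 8(7)] l by simp
    fix n assume n: "?s L \<rightarrow>\<^sub>P* numeral_pcf n"
    let ?X = "if n = 0 then P else Q"
    have "EAM (?R (num n)) (Body ?I) [] \<rightarrow>\<^sub>c* EAM (?R (?d ?X)) (Body (Call 0)) []"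
      by (rule TestI_steps[where n = n and b = "?d ?X"]) (simp_all add: reads_def)
    also have "\<dots> \<rightarrow>\<^sub>c* lookup (?d ?X) @@ []"
      by (rule Call_steps) (simp add: reads_def)
    finally (steps_trans) have "EAM ((?R (?d L))[0 := Some (num n)]) (Body ?I) [] \<rightarrow>\<^sub>c* ?t ?X @@ as"
      using l by (cases "n = 0") simp_all
    moreover have "Ifz (?s L) (?s P) (?s Q) \<rightarrow>\<^sub>P* ?s ?X"
      using Ifz_numeral_steps[OF n, of "?s P" "?s Q"] by (cases "n = 0") simp_all
    moreover have "approx \<alpha> d k (?t ?X @@ as) (?s ?X)"
      using 8(5,6)[OF 8(7)] by (cases "n = 0") simp_all
    ultimately show "approx \<alpha> d k (EAM ((?R (?d L))[0 := Some (num n)]) (Body ?I) []) (Ifz (?s L) (?s P) (?s Q))"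
      by (rule approx_expand)
  qed auto
  ultimately show ?case
    unfolding msubst_simps by (rule approx_expand_left)
qed

lemma Tr_typed: "pcf_program P \<alpha> \<Longrightarrow> eam_typed (Tr P) \<alpha>"
  using translate_typed[of "[]" P \<alpha>] by (simp add: Tr_def)

lemma Tr_approx: "pcf_program P \<alpha> \<Longrightarrow> approx \<alpha> d k (Tr P) P"
  using translate_approx[of "[]" P \<alpha> d k "[]" "[]"] related_Nil by (simp add: Tr_def)

subsection \<open>From approximations to the logical relation\<close>

text \<open>Here arguments agree exactly. Recursion cannot be treated with this relation directly,
  but it composes with the logical relation on machines.\<close>

primrec sim :: "ty \<Rightarrow> 'a eam \<Rightarrow> pcf \<Rightarrow> bool" where
  "sim IntT M P \<longleftrightarrow> (\<forall>n. M \<rightarrow>\<^sub>c* numeral_eam num n \<longleftrightarrow> P \<rightarrow>\<^sub>P* numeral_pcf n)"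
| "sim (\<alpha> \<rightarrow>\<^sub>t \<beta>) M P \<longleftrightarrow> (\<forall>a\<in>typed_addrs \<alpha>. \<forall>Q. pcf_program Q \<alpha> \<longrightarrow>
    sim \<alpha> (lookup a) Q \<longrightarrow> sim \<beta> (M @@ [a]) (App P Q))"

lemma typed_definable:
  assumes "a \<in> typed_addrs \<alpha>"
  obtains Q where "pcf_program Q \<alpha>" "\<And>d k. approx \<alpha> d k (lookup a) Q"
  using assms typed_definable_ex(1) unfolding typed_addrs_def by blast

definition tr_addr :: "pcf \<Rightarrow> 'a" where
  "tr_addr P = addr (Tr P)"

lemma lookup_tr_addr: "pcf_program P \<alpha> \<Longrightarrow> lookup (tr_addr P) = Tr P"
  unfolding tr_addr_def by (intro lookup_addr typed_valid(1) Tr_typed)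

lemma tr_addr_typed: "pcf_program P \<alpha> \<Longrightarrow> tr_addr P \<in> typed_addrs \<alpha>"
  by (simp add: typed_addrs_def lookup_tr_addr Tr_typed)

text \<open>
  The last two properties allow to replace an argument that is only approximated by one that is
  definable, which is what the first one needs at function types.
\<close>

lemma sim_approx:
  "(\<forall>M P. eam_typed M \<alpha> \<longrightarrow> pcf_program P \<alpha> \<longrightarrow> sim \<alpha> M P \<longrightarrow> (\<forall>d k. approx \<alpha> d k M P)) \<and>
   (\<forall>M P. (\<forall>d k. approx \<alpha> d k M P) \<longrightarrow> sim \<alpha> M P) \<and>
   (\<forall>k M N P P'. approx \<alpha> True k M P \<longrightarrow> sim \<alpha> N P \<longrightarrow> sim \<alpha> N P' \<longrightarrow> approx \<alpha> True k M P') \<and>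
   (\<forall>k M M' P Q. approx \<alpha> False k M P \<longrightarrow> sim \<alpha> M Q \<longrightarrow> sim \<alpha> M' Q \<longrightarrow> approx \<alpha> False k M' P)"
  (is "?A \<alpha> \<and> ?B \<alpha> \<and> ?T \<alpha> \<and> ?F \<alpha>")
proof (induction \<alpha>)
  case IntT
  have "sim IntT M P" if *: "\<forall>d k. approx IntT d k M P" for M P
  proof -
    have "P \<rightarrow>\<^sub>P* numeral_pcf n" if M: "M \<rightarrow>\<^sub>c* numeral_eam num n" for n
    proof -
      from M obtain j where "(step ^^ j) M (numeral_eam num n)" by (metis rtranclp_imp_relpowp)
      with *[rule_format, of True j] show ?thesis by (simp, blast)
    qed
    moreover have "M \<rightarrow>\<^sub>c* numeral_eam num n" if P: "P \<rightarrow>\<^sub>P* numeral_pcf n" for n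
    proof -
      from P obtain j where "(pcf_step ^^ j) P (numeral_pcf n)" by (metis rtranclp_imp_relpowp)
      with *[rule_format, of False j] show ?thesis by (simp, blast)
    qed
    ultimately show ?thesis by auto
  qed
  \<comment> \<open>At \<open>IntT\<close> the two exchange properties are immediate, because having
    the same values as a common partner means having the same values.\<close>
  then show ?case
    by (auto dest: relpowp_imp_rtranclp)
next
  case (Arrow \<alpha> \<beta>)
  note IH\<alpha> = Arrow.IH(1)[THEN conjunct1] Arrow.IH(1)[THEN conjunct2, THEN conjunct1]
  note IH\<beta> = Arrow.IH(2)[THEN conjunct2, THEN conjunct1]
    Arrow.IH(2)[THEN conjunct2, THEN conjunct2, THEN conjunct1]
    Arrow.IH(2)[THEN conjunct2, THEN conjunct2, THEN conjunct2]
  have tr: "sim \<alpha> (lookup (tr_addr Q)) Q" if "pcf_program Q \<alpha>" for Q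
    using IH\<alpha>(2) Tr_approx that by (simp add: lookup_tr_addr)
  have B: "sim (\<alpha> \<rightarrow>\<^sub>t \<beta>) M P" if *: "\<forall>d k. approx (\<alpha> \<rightarrow>\<^sub>t \<beta>) d k M P" for M P
    unfolding sim.simps
  proof (intro ballI allI impI)
    fix a Q assume a: "a \<in> typed_addrs \<alpha>" "pcf_program Q \<alpha>" "sim \<alpha> (lookup a) Q"
    then have "approx \<alpha> d k (lookup a) Q" for d k
      using IH\<alpha>(1) by (simp add: typed_addrs_def)
    with * a(1,2) have "approx \<beta> d k (M @@ [a]) (App P Q)" for d k
      by (meson approx.simps(2) order_refl)
    with IH\<beta>(1) show "sim \<beta> (M @@ [a]) (App P Q)" by blast
  qed
  have A: "approx (\<alpha> \<rightarrow>\<^sub>t \<beta>) d k M P"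
    if M: "eam_typed M (\<alpha> \<rightarrow>\<^sub>t \<beta>)" and P: "pcf_program P (\<alpha> \<rightarrow>\<^sub>t \<beta>)" and MP: "sim (\<alpha> \<rightarrow>\<^sub>t \<beta>) M P"
    for M P d k
    unfolding approx.simps
  proof (intro ballI allI impI)
    fix j a Q assume a: "a \<in> typed_addrs \<alpha>" "pcf_program Q \<alpha>" "approx \<alpha> d j (lookup a) Q"
    show "approx \<beta> d j (M @@ [a]) (App P Q)"
    proof (cases d)
      case True
      \<comment> \<open>As \<open>Q\<close> merely approximates \<open>a\<close>, the hypothesis on
        \<open>M\<close> and \<open>P\<close> does not apply to this pair. The term
        \<open>P'\<close> defining \<open>M\<close> accepts the pair, and may be exchanged for
        \<open>P\<close>: after application to \<open>Q\<close>, both correspond exactly to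
        \<open>M\<close> on the translation of \<open>Q\<close>.\<close>
      obtain P' where P': "pcf_program P' (\<alpha> \<rightarrow>\<^sub>t \<beta>)" "\<And>d k. approx (\<alpha> \<rightarrow>\<^sub>t \<beta>) d k M P'"
        using typed_definable_ex(1)[OF M] by blast
      have "approx \<beta> True j (M @@ [a]) (App P' Q)"
        using P'(2)[of True j] a True by simp
      moreover have "sim \<beta> (M @@ [tr_addr Q]) (App P' Q)" "sim \<beta> (M @@ [tr_addr Q]) (App P Q)"
        using B P'(2) MP tr[OF a(2)] tr_addr_typed[OF a(2)] a(2) by auto
      ultimately have "approx \<beta> True j (M @@ [a]) (App P Q)" using IH\<beta>(2) by blast
      with True show ?thesis by simp
    next
      case False
      \<comment> \<open>Dually, the machine is exchanged: the translation of \<open>P\<close>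
        accepts the pair, and it and \<open>M\<close>, both run on \<open>a\<close>, correspond
        exactly to \<open>P\<close> applied to the program \<open>R\<close> that defines
        \<open>a\<close>.\<close>
      obtain R where R: "pcf_program R \<alpha>" "\<And>d k. approx \<alpha> d k (lookup a) R"
        using typed_definable[OF a(1)] by blast
      have "approx \<beta> False j (Tr P @@ [a]) (App P Q)"
        using Tr_approx[OF P, of False j] a False by simp
      moreover have "sim \<alpha> (lookup a) R" using IH\<alpha>(2) R(2) by blast
      then have "sim \<beta> (Tr P @@ [a]) (App P R)" "sim \<beta> (M @@ [a]) (App P R)"
        using B Tr_approx[OF P] MP a(1) R(1) by auto
      ultimately have "approx \<beta> False j (M @@ [a]) (App P Q)" using IH\<beta>(3) by blast
      with False show ?thesis by simp
    qed
  qed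
  \<comment> \<open>The exchange lifts to function types by letting the common partner act on an
    argument that corresponds exactly to the given one: here the translation of the program, below
    for the other direction the program defining the machine.\<close>
  have T: "approx (\<alpha> \<rightarrow>\<^sub>t \<beta>) True k M P'"
    if *: "approx (\<alpha> \<rightarrow>\<^sub>t \<beta>) True k M P" "sim (\<alpha> \<rightarrow>\<^sub>t \<beta>) N P" "sim (\<alpha> \<rightarrow>\<^sub>t \<beta>) N P'" for k M N P P'
    unfolding approx.simps
  proof (intro ballI allI impI)
    fix j a Q assume j: "j \<le> k" and a: "a \<in> typed_addrs \<alpha>" "pcf_program Q \<alpha>" "approx \<alpha> True j (lookup a) Q"
    have "approx \<beta> True j (M @@ [a]) (App P Q)" using *(1) j a by simp
    moreover have "sim \<beta> (N @@ [tr_addr Q]) (App P Q)" "sim \<beta> (N @@ [tr_addr Q]) (App P' Q)"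
      using *(2,3) tr[OF a(2)] tr_addr_typed[OF a(2)] a(2) by auto
    ultimately show "approx \<beta> True j (M @@ [a]) (App P' Q)" using IH\<beta>(2) by blast
  qed
  have F: "approx (\<alpha> \<rightarrow>\<^sub>t \<beta>) False k M' P"
    if *: "approx (\<alpha> \<rightarrow>\<^sub>t \<beta>) False k M P" "sim (\<alpha> \<rightarrow>\<^sub>t \<beta>) M Q" "sim (\<alpha> \<rightarrow>\<^sub>t \<beta>) M' Q" for k M M' P Q
    unfolding approx.simps
  proof (intro ballI allI impI)
    fix j a S assume j: "j \<le> k" and a: "a \<in> typed_addrs \<alpha>" "pcf_program S \<alpha>" "approx \<alpha> False j (lookup a) S"
    obtain R where R: "pcf_program R \<alpha>" "\<And>d k. approx \<alpha> d k (lookup a) R"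
      using typed_definable[OF a(1)] by blast
    then have "sim \<alpha> (lookup a) R" using IH\<alpha>(2) by blast
    with *(2,3) a(1) R(1) have "sim \<beta> (M @@ [a]) (App Q R)" "sim \<beta> (M' @@ [a]) (App Q R)" by auto
    moreover have "approx \<beta> False j (M @@ [a]) (App P S)" using *(1) j a by simp
    ultimately show "approx \<beta> False j (M' @@ [a]) (App P S)" using IH\<beta>(3) by blast
  qed
  from A B T F show ?case by blast
qed

lemma sim_definable:
  assumes "a \<in> typed_addrs \<alpha>"
  obtains Q where "pcf_program Q \<alpha>" "sim \<alpha> (lookup a) Q"
  using typed_definable[OF assms] sim_approx by metis

lemma Tr_sim: "pcf_program P \<alpha> \<Longrightarrow> sim \<alpha> (Tr P) P"
  using sim_approx Tr_approx by blast

text \<open>The two halves support each other. For the first at a function type, the argument has to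
  be related to itself, which the second half yields from its partner program. For the second,
  definability provides a program for one argument and the first half passes it to the other
  argument.\<close>

lemma log_rel_sim:
  "(\<forall>M N P. log_rel \<alpha> M N \<longrightarrow> sim \<alpha> M P \<longrightarrow> sim \<alpha> N P) \<and>
   (\<forall>M N P. sim \<alpha> M P \<longrightarrow> sim \<alpha> N P \<longrightarrow> log_rel \<alpha> M N)"
proof (induction \<alpha>)
  case (Arrow \<alpha> \<beta>)
  have "sim \<beta> (N @@ [a]) (App P Q)"
    if "log_rel (\<alpha> \<rightarrow>\<^sub>t \<beta>) M N" "sim (\<alpha> \<rightarrow>\<^sub>t \<beta>) M P"
      and a: "a \<in> typed_addrs \<alpha>" "pcf_program Q \<alpha>" "sim \<alpha> (lookup a) Q" for M N P a Q
  proof -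
    from a(3) Arrow.IH(1) have "log_rel \<alpha> (lookup a) (lookup a)" by blast
    with that have "log_rel \<beta> (M @@ [a]) (N @@ [a])" "sim \<beta> (M @@ [a]) (App P Q)" by auto
    with Arrow.IH(2) show ?thesis by blast
  qed
  moreover have "log_rel \<beta> (M @@ [a]) (N @@ [b])"
    if "sim (\<alpha> \<rightarrow>\<^sub>t \<beta>) M P" "sim (\<alpha> \<rightarrow>\<^sub>t \<beta>) N P"
      and ab: "a \<in> typed_addrs \<alpha>" "b \<in> typed_addrs \<alpha>" "log_rel \<alpha> (lookup a) (lookup b)" for M N P a b
  proof -
    obtain Q where Q: "pcf_program Q \<alpha>" "sim \<alpha> (lookup a) Q" using sim_definable[OF ab(1)] .
    with ab(3) Arrow.IH(1) have "sim \<alpha> (lookup b) Q" by blast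
    with that Q have "sim \<beta> (M @@ [a]) (App P Q)" "sim \<beta> (N @@ [b]) (App P Q)" by auto
    with Arrow.IH(2) show ?thesis by blast
  qed
  ultimately show ?case unfolding sim.simps log_rel.simps by blast
qed simp

section \<open>Observational equivalence and exchange of programs\<close>

lemma plug_foldl: "plug (foldl CAppL C Qs) P = foldl App (plug C P) Qs"
  by (induction Qs arbitrary: C) auto

lemma ctx_typed_foldl:
  "programs \<tau>s Qs \<Longrightarrow> ctx_typed \<alpha> \<Gamma> C (foldr (\<rightarrow>\<^sub>t) \<tau>s \<beta>) \<Longrightarrow> ctx_typed \<alpha> \<Gamma> (foldl CAppL C Qs) \<beta>"
proof (induction arbitrary: C rule: programs_induct)
  case (Cons \<tau> \<tau>s Q Qs)
  then show ?case
    using ctx_typed.intros(2)[of \<alpha> \<Gamma> C \<tau> "arrows \<tau>s \<beta>" Q] by (simp add: program_typed_any)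
qed simp

text \<open>Every type is a sequence of arrows ending in \<open>IntT\<close>. The partner program of
  each argument is collected until \<open>IntT\<close> is reached, where only the value of the
  complete application counts.\<close>

lemma sim_app_equiv:
  "(\<And>\<tau>s Qs n. \<alpha> = arrows \<tau>s IntT \<Longrightarrow> programs \<tau>s Qs \<Longrightarrow>
      foldl App P Qs \<rightarrow>\<^sub>P* numeral_pcf n \<longleftrightarrow> foldl App P' Qs \<rightarrow>\<^sub>P* numeral_pcf n) \<Longrightarrow>
    sim \<alpha> M P \<Longrightarrow> sim \<alpha> M P'"
proof (induction \<alpha> arbitrary: M P P')
  case IntT
  from IntT(1)[of "[]" "[]"] IntT(2) show ?case by simp
next
  case (Arrow \<alpha> \<beta>)
  show ?case
    unfolding sim.simps
  proof (intro ballI allI impI)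
    fix a Q assume a: "a \<in> typed_addrs \<alpha>" "pcf_program Q \<alpha>" "sim \<alpha> (lookup a) Q"
    show "sim \<beta> (M @@ [a]) (App P' Q)"
    proof (rule Arrow.IH(2))
      show "sim \<beta> (M @@ [a]) (App P Q)" using Arrow.prems(2) a by simp
      show "foldl App (App P Q) Qs \<rightarrow>\<^sub>P* numeral_pcf n \<longleftrightarrow> foldl App (App P' Q) Qs \<rightarrow>\<^sub>P* numeral_pcf n"
        if "\<beta> = arrows \<tau>s IntT" "programs \<tau>s Qs" for \<tau>s Qs n
        using Arrow.prems(1)[of "\<alpha> # \<tau>s" "Q # Qs" n] that a(2) by simp
    qed
  qed
qed

text \<open>The tests required are the contexts that apply the hole to a list of programs.\<close>

lemma sim_obs_equiv:
  assumes "obs_equiv \<alpha> P P'" "sim \<alpha> M P"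
  shows "sim \<alpha> M P'"
proof (rule sim_app_equiv[OF _ assms(2)])
  fix \<tau>s Qs n assume "\<alpha> = arrows \<tau>s IntT" "programs \<tau>s Qs"
  then have "ctx_typed \<alpha> [] (foldl CAppL Hole Qs) IntT"
    using ctx_typed.intros(1) by (intro ctx_typed_foldl) auto
  with assms(1) show "foldl App P Qs \<rightarrow>\<^sub>P* numeral_pcf n \<longleftrightarrow> foldl App P' Qs \<rightarrow>\<^sub>P* numeral_pcf n"
    unfolding obs_equiv_def by (metis plug_foldl plug.simps(1))
qed

end

theorem theorem5p19:
  fixes num :: "nat \<Rightarrow> 'a" and addr :: "'a eam \<Rightarrow> 'a" and y :: 'a
    and \<alpha> :: ty and P\<^sub>1 P\<^sub>2 :: pcf
  assumes "address_map num addr y"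
    and "pcf_program P\<^sub>1 \<alpha>" and "pcf_program P\<^sub>2 \<alpha>"
    and "obs_equiv \<alpha> P\<^sub>1 P\<^sub>2"
  shows "address_map.log_rel num addr y \<alpha> (address_map.Tr num addr y P\<^sub>1) (address_map.Tr num addr y P\<^sub>2)"
proof -
  interpret address_map num addr y by (rule assms(1))
  \<comment> \<open>The second program becomes a common partner of both translations.\<close>
  have "sim \<alpha> (Tr P\<^sub>1) P\<^sub>2"
    using sim_obs_equiv[OF assms(4) Tr_sim[OF assms(2)]] .
  with Tr_sim[OF assms(3)] log_rel_sim show ?thesis by blast
qed

end
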